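(* Let $K$ be a commutative ring with unit and $E$ a graph. Then the following are equivalent: (1) the Leavitt path algebra $L_K(E)$ is stably finite; (2) $L_K(E)$ is Dedekind finite; (3) $E$ is a no-exit graph.
   Context: Rings are not assumed unital. A ring $R$ is Dedekind finite if for every idempotent $e\in R$ and all $u,v\in eRe$, $uv=e$ implies $vu=e$; $R$ is stably finite if $M_n(R)$ is Dedekind finite for all $n\geq 1$. A graph $E=(E^{(0)},E^{(1)})$ is a directed graph with vertex set $E^{(0)}$ and edge set $E^{(1)}$ (loops and multiple edges allowed); $\boldsymbol d(e)$ and $\boldsymbol r(e)$ denote the initial and terminal vertices of an edge (or path) $e$, and paths are composed from left to right. A cycle is a nonempty closed path in which the terminal vertex is the first repeated vertex. $E$ is no-exit if no cycle has an exit, i.e., each vertex on a cycle has out-degree $1$. Let $E^\ast$ be the set of all finite paths in $E$, including an empty path at each vertex $v$, denoted again by $v$. The graph inverse semigroup $P_E$ is the inverse semigroup, under composition of partial maps, consisting of the empty map (its zero element) and all partial bijections of $E^\ast$ of the form $qx\mapsto px$, denoted $pq^\ast$, where $p,q\in E^\ast$ end at the same vertex. A vertex $v$ is identified with the element $vv^\ast$ of $P_E$. A vertex is regular if it emits at least one and only finitely many edges. $L_K(E)$ is the quotient of the semigroup algebra $KP_E$ (in which the zero of $P_E$ is not identified with $0$) by the ideal generated by the zero element of $P_E$ and the elements $v-\sum_{\boldsymbol d(e)=v}ee^\ast$ with $v$ a regular vertex. *)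

theory Defs
  imports
    "HOL-Algebra.QuotRing"
    "HOL-Library.Poly_Mapping"
    "Graph_Theory.Arc_Walk"
    "Jordan_Normal_Form.Matrix"
begin

section \<open>Dedekind finite and stably finite non-unital rings\<close>

text \<open>
  Rings here need not be unital. They are nevertheless carried by the library's ring records, whose
  field \<open>one\<close> is then meaningless: none of the notions below inspects it, and it is left
  \<open>undefined\<close> where a record is built explicitly.
\<close>

definition corner :: "('r, 'm) ring_scheme \<Rightarrow> 'r \<Rightarrow> 'r set" where
  "corner R e = {e \<otimes>\<^bsub>R\<^esub> x \<otimes>\<^bsub>R\<^esub> e | x. x \<in> carrier R}"

definition dedekind_finite :: "('r, 'm) ring_scheme \<Rightarrow> bool" where
  "dedekind_finite R \<longleftrightarrow>
     (\<forall>e \<in> carrier R. e \<otimes>\<^bsub>R\<^esub> e = e \<longrightarrow>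
        (\<forall>u \<in> corner R e. \<forall>v \<in> corner R e. u \<otimes>\<^bsub>R\<^esub> v = e \<longrightarrow> v \<otimes>\<^bsub>R\<^esub> u = e))"

text \<open>
  Only the container type of \<open>Jordan_Normal_Form\<close> matrices is used; its own arithmetic is that of
  type-class rings, whereas the entries here live in the carrier of \<open>R\<close>.
\<close>

definition matrix_rng :: "nat \<Rightarrow> ('r, 'm) ring_scheme \<Rightarrow> 'r mat ring" where
  "matrix_rng n R =
     \<lparr>carrier = {A \<in> carrier_mat n n. \<forall>i<n. \<forall>j<n. A $$ (i, j) \<in> carrier R},
      monoid.mult = (\<lambda>A B. mat n n (\<lambda>(i, j). \<Oplus>\<^bsub>R\<^esub>k\<in>{..<n}. A $$ (i, k) \<otimes>\<^bsub>R\<^esub> B $$ (k, j))),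
      one = undefined,
      zero = mat n n (\<lambda>_. \<zero>\<^bsub>R\<^esub>),
      add = (\<lambda>A B. mat n n (\<lambda>(i, j). A $$ (i, j) \<oplus>\<^bsub>R\<^esub> B $$ (i, j)))\<rparr>"

definition stably_finite :: "('r, 'm) ring_scheme \<Rightarrow> bool" where
  "stably_finite R \<longleftrightarrow> (\<forall>n\<ge>1. dedekind_finite (matrix_rng n R))"


section \<open>No-exit graphs\<close>

definition no_exit :: "('a, 'b) pre_digraph \<Rightarrow> bool" where
  "no_exit E \<longleftrightarrow>
     (\<forall>c. pre_digraph.cycle E c \<longrightarrow> (\<forall>e \<in> set c. out_degree E (tail E e) = 1))"


section \<open>The graph inverse semigroup\<close>

text \<open>
  A path is given by its initial vertex and its list of edges, so that \<open>(v, [])\<close> is the empty path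
  at \<open>v\<close>.
\<close>

type_synonym ('a, 'b) path = "'a \<times> 'b list"

definition paths :: "('a, 'b) pre_digraph \<Rightarrow> ('a, 'b) path set" where
  "paths E = {(u, es). \<exists>v. pre_digraph.awalk E u es v}"

definition path_end :: "('a, 'b) pre_digraph \<Rightarrow> ('a, 'b) path \<Rightarrow> 'a" where
  "path_end E p = pre_digraph.awlast E (fst p) (snd p)"

text \<open>The product of two paths; meaningful if the second starts where the first ends.\<close>

definition path_append :: "('a, 'b) path \<Rightarrow> ('a, 'b) path \<Rightarrow> ('a, 'b) path" where
  "path_append p x = (fst p, snd p @ snd x)"

text \<open>
  A partial map is represented by its graph, a set of pairs (argument, value). Partial maps act on
  the left, so \<open>f\<close> after \<open>g\<close> is the relational composition \<open>g O f\<close>.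
\<close>

type_synonym ('a, 'b) path_map = "(('a, 'b) path \<times> ('a, 'b) path) set"

definition path_star :: "('a, 'b) pre_digraph \<Rightarrow> ('a, 'b) path \<Rightarrow> ('a, 'b) path \<Rightarrow> ('a, 'b) path_map" where
  "path_star E p q =
     {(path_append q x, path_append p x) | x. x \<in> paths E \<and> fst x = path_end E q}"

definition graph_inverse_semigroup :: "('a, 'b) pre_digraph \<Rightarrow> ('a, 'b) path_map set" where
  "graph_inverse_semigroup E =
     insert {} {path_star E p q | p q. p \<in> paths E \<and> q \<in> paths E \<and> path_end E p = path_end E q}"

definition pm_comp :: "('a, 'b) path_map \<Rightarrow> ('a, 'b) path_map \<Rightarrow> ('a, 'b) path_map" where
  "pm_comp f g = g O f"


section \<open>Semigroup algebras and Leavitt path algebras\<close>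

definition semigroup_algebra ::
  "'s set \<Rightarrow> ('s \<Rightarrow> 's \<Rightarrow> 's) \<Rightarrow> ('k::comm_ring_1, 's \<Rightarrow>\<^sub>0 'k) module" where
  "semigroup_algebra S m =
     \<lparr>carrier = {f. Poly_Mapping.keys f \<subseteq> S},
      monoid.mult = (\<lambda>f g. \<Sum>s\<in>Poly_Mapping.keys f. \<Sum>t\<in>Poly_Mapping.keys g.
                Poly_Mapping.single (m s t) (Poly_Mapping.lookup f s * Poly_Mapping.lookup g t)),
      one = undefined,
      zero = 0,
      add = (+),
      smult = (\<lambda>c. Poly_Mapping.map ((*) c))\<rparr>"

text \<open>The library's \<open>ideal\<close> and \<open>genideal\<close> presuppose a unital ring.\<close>

definition algebra_ideal :: "'r set \<Rightarrow> ('k, 'r, 'm) module_scheme \<Rightarrow> bool" where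
  "algebra_ideal I A \<longleftrightarrow>
     additive_subgroup I A \<and>
     (\<forall>c. \<forall>a \<in> I. c \<odot>\<^bsub>A\<^esub> a \<in> I) \<and>
     (\<forall>a \<in> I. \<forall>x \<in> carrier A. x \<otimes>\<^bsub>A\<^esub> a \<in> I \<and> a \<otimes>\<^bsub>A\<^esub> x \<in> I)"

definition ideal_generated :: "('k, 'r, 'm) module_scheme \<Rightarrow> 'r set \<Rightarrow> 'r set" where
  "ideal_generated A X = \<Inter>{I. algebra_ideal I A \<and> X \<subseteq> I}"

definition graph_semigroup_algebra ::
  "'k::comm_ring_1 itself \<Rightarrow> ('a, 'b) pre_digraph \<Rightarrow> ('k, ('a, 'b) path_map \<Rightarrow>\<^sub>0 'k) module" where
  "graph_semigroup_algebra K E = semigroup_algebra (graph_inverse_semigroup E) pm_comp"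

definition regular_vertex :: "('a, 'b) pre_digraph \<Rightarrow> 'a \<Rightarrow> bool" where
  "regular_vertex E v \<longleftrightarrow> v \<in> verts E \<and> out_arcs E v \<noteq> {} \<and> finite (out_arcs E v)"

definition vertex_elem :: "('a, 'b) pre_digraph \<Rightarrow> 'a \<Rightarrow> ('a, 'b) path_map" where
  "vertex_elem E v = path_star E (v, []) (v, [])"

definition edge_proj :: "('a, 'b) pre_digraph \<Rightarrow> 'b \<Rightarrow> ('a, 'b) path_map" where
  "edge_proj E e = path_star E (tail E e, [e]) (tail E e, [e])"

text \<open>
  The first relator is the basis element belonging to the zero \<open>{}\<close> of the semigroup, which differs
  from the zero of the semigroup algebra.
\<close>

definition leavitt_relators ::
  "'k::comm_ring_1 itself \<Rightarrow> ('a, 'b) pre_digraph \<Rightarrow> (('a, 'b) path_map \<Rightarrow>\<^sub>0 'k) set" where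
  "leavitt_relators K E =
     insert (Poly_Mapping.single {} 1)
       {Poly_Mapping.single (vertex_elem E v) 1
          - (\<Sum>e\<in>out_arcs E v. Poly_Mapping.single (edge_proj E e) 1) | v. regular_vertex E v}"

definition leavitt_path_algebra ::
  "'k::comm_ring_1 itself \<Rightarrow> ('a, 'b) pre_digraph \<Rightarrow> (('a, 'b) path_map \<Rightarrow>\<^sub>0 'k) set ring" where
  "leavitt_path_algebra K E =
     graph_semigroup_algebra K E Quot
       ideal_generated (graph_semigroup_algebra K E) (leavitt_relators K E)"

end

theory Submission
  imports Defs "Jordan_Normal_Form.Determinant"
begin

text \<open>A finite system cannot be faithful on the whole algebra. The corner at a loop without
  exit is a ring of Laurent polynomials over \<open>K\<close>, and on finitely many points its
  generator acts as a permutation of some finite order \<open>N\<close>, so that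
  \<open>x^N - 1\<close> is lost. Hence faithfulness is asked on finite sets only, and
  \<open>N\<close> has to exceed the path lengths that occur there. A second obstacle is that
  \<open>E\<close> may have infinitely many arcs, even at one vertex. A finite system sees finitely
  many arcs only; a vertex with no relation among the arcs of \<open>F\<close> must therefore keep a
  point outside all their images. Since each element of the ideal asks for its own \<open>F\<close>,
  statements about the ideal are made along the filter of finite sets of arcs. Finally,
  \<open>K\<close> is merely a commutative ring, so independence of operators cannot rest on
  dimension or division: a coefficient is recovered as one value of the action on an indicator
  function.\<close>

text \<open>
  Let a finite set \<open>F\<close> of arcs act on a set by injections with disjoint images (a branching system).
  Every element of the ideal of Leavitt relations acts as \<open>0\<close> once \<open>F\<close> is large enough.

  If a cycle \<open>c\<close> based at \<open>v\<close> has an exit there, then \<open>c\<^sup>*c = v\<close>, and a branching system on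
  \<open>vertices \<times> \<nat>\<close> contains a point over \<open>v\<close> in the image of the exit, hence not in that of \<open>c\<close>, so that
  \<open>cc\<^sup>* \<noteq> v\<close>.

  If no cycle has an exit, there are finite branching systems that are faithful on any prescribed
  finite set of elements. So a failure of Dedekind finiteness in a matrix ring over the Leavitt path
  algebra, which involves finitely many elements only, would be visible in a ring of square matrices
  over \<open>K\<close>, where one-sided inverses are two-sided because determinants are multiplicative.
\<close>

section \<open>Matrices over a commutative ring\<close>

text \<open>\<open>det A\<close> is invertible with inverse \<open>det B\<close>, so the adjugate,
  scaled by \<open>det B\<close>, is a left inverse of \<open>A\<close>; a left inverse and a right
  inverse coincide.\<close>

lemma mat_left_right_inverse_comm:
  fixes A B :: "'k::comm_ring_1 mat"
  assumes A: "A \<in> carrier_mat n n" and B: "B \<in> carrier_mat n n" and AB: "A * B = 1\<^sub>m n"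
  shows "B * A = 1\<^sub>m n"
proof -
  define L where "L = det B \<cdot>\<^sub>m adj_mat A"
  have adj: "adj_mat A \<in> carrier_mat n n" "adj_mat A * A = det A \<cdot>\<^sub>m 1\<^sub>m n"
    using adj_mat[OF A] by auto
  have L: "L \<in> carrier_mat n n" unfolding L_def using adj by auto
  have "det A * det B = 1"
    using det_mult[OF A B] AB by simp
  then have "L * A = 1\<^sub>m n"
    unfolding L_def using adj A
    by (auto simp: mult_smult_assoc_mat[of _ n n _ n] mult.commute intro!: eq_matI)
  moreover have "L = B"
  proof -
    have "L = L * (A * B)" using L AB by simp
    also have "\<dots> = (L * A) * B" using L A B by (simp add: assoc_mult_mat[of _ n n _ n _ n])
    also have "\<dots> = B" using B \<open>L * A = 1\<^sub>m n\<close> by simp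
    finally show ?thesis .
  qed
  ultimately show ?thesis by simp
qed

text \<open>Adding the complementary idempotent \<open>W = 1 - E\<close> to \<open>U\<close> and
  \<open>V\<close> turns an identity in the corner into one in the full matrix ring: all mixed
  products with \<open>W\<close> vanish.\<close>

lemma mat_corner_dedekind_finite:
  fixes E U V :: "'k::comm_ring_1 mat"
  assumes E: "E \<in> carrier_mat n n" and U: "U \<in> carrier_mat n n" and V: "V \<in> carrier_mat n n"
    and "E * E = E" "E * U = U" "U * E = U" "E * V = V" "V * E = V" "U * V = E"
  shows "V * U = E"
proof -
  define W where "W = 1\<^sub>m n - E"
  have W: "W \<in> carrier_mat n n" using E by (auto simp: W_def)
  have z: "X * W = 0\<^sub>m n n" if "X \<in> carrier_mat n n" "X * E = X" for X
    using that E by (simp add: W_def mult_minus_distrib_mat[of _ n n _ n])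
  have z': "W * X = 0\<^sub>m n n" if "X \<in> carrier_mat n n" "E * X = X" for X
    using that E by (simp add: W_def minus_mult_distrib_mat[of _ n n _ _ n])
  have WW: "W * W = W"
  proof -
    have "W * W = 1\<^sub>m n * W - E * W"
      using E W by (subst (1) W_def) (simp add: minus_mult_distrib_mat[of _ n n _ _ n])
    then show ?thesis using z[OF E] assms W by (auto simp: carrier_matD intro!: eq_matI)
  qed
  have expand: "(A + W) * (B + W) = A * B + W"
    if "A \<in> carrier_mat n n" "B \<in> carrier_mat n n" "A * E = A" "E * B = B" for A B
  proof -
    have "(A + W) * (B + W) = (A * B + A * W) + (W * B + W * W)"
      using that W add_mult_distrib_mat[of A n n W "B + W" n]
      by (simp add: mult_add_distrib_mat[of _ n n _ n])
    also have "\<dots> = A * B + W"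
      using that W z[of A] z'[of B] by (simp add: WW)
    finally show ?thesis .
  qed
  have c: "U + W \<in> carrier_mat n n" "V + W \<in> carrier_mat n n"
    using W U V by auto
  have "(U + W) * (V + W) = 1\<^sub>m n"
    using expand[OF U V] assms by (auto simp: W_def intro!: eq_matI)
  from mat_left_right_inverse_comm[OF c this] have "V * U + W = 1\<^sub>m n"
    using expand[OF V U] assms by simp
  then have **: "V * U + (1\<^sub>m n - E) = 1\<^sub>m n" by (simp add: W_def)
  show ?thesis
  proof (rule eq_matI)
    fix i j assume "i < dim_row E" "j < dim_col E"
    then show "(V * U) $$ (i, j) = E $$ (i, j)"
      using arg_cong[OF **, of "\<lambda>M. M $$ (i, j)"] E U V
      by (simp del: index_mult_mat(1))
  qed (use E U V in auto)
qed

text \<open>Matrix multiplication for matrices indexed by a finite set of an arbitrary type, such as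
  a set of points. Values off \<open>S\<close> are left unconstrained, so identities are stated on
  \<open>S\<close> only.\<close>

definition kmult :: "'i set \<Rightarrow> ('i \<Rightarrow> 'i \<Rightarrow> 'k::comm_ring_1) \<Rightarrow> ('i \<Rightarrow> 'i \<Rightarrow> 'k) \<Rightarrow> 'i \<Rightarrow> 'i \<Rightarrow> 'k" where
  "kmult S A B = (\<lambda>s t. \<Sum>r\<in>S. A s r * B r t)"

lemma kernel_corner_dedekind_finite:
  fixes E X Y U V :: "'i \<Rightarrow> 'i \<Rightarrow> 'k::comm_ring_1"
  assumes S: "finite S"
    and E: "\<And>s t. s \<in> S \<Longrightarrow> t \<in> S \<Longrightarrow> kmult S E E s t = E s t"
    and U: "\<And>s t. s \<in> S \<Longrightarrow> t \<in> S \<Longrightarrow> kmult S (kmult S E X) E s t = U s t"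
    and V: "\<And>s t. s \<in> S \<Longrightarrow> t \<in> S \<Longrightarrow> kmult S (kmult S E Y) E s t = V s t"
    and UV: "\<And>s t. s \<in> S \<Longrightarrow> t \<in> S \<Longrightarrow> kmult S U V s t = E s t"
    and st: "s \<in> S" "t \<in> S"
  shows "kmult S V U s t = E s t"
proof -
  define m where "m = card S"
  obtain h where h: "bij_betw h {0..<m} S"
    using ex_bij_betw_nat_finite[OF S] unfolding m_def by blast
  define M where "M = (\<lambda>A::'i \<Rightarrow> 'i \<Rightarrow> 'k. mat m m (\<lambda>(i,j). A (h i) (h j)))"
  have MM: "M A * M B = M (kmult S A B)" for A B
  proof (rule eq_matI)
    fix i j assume "i < dim_row (M (kmult S A B))" "j < dim_col (M (kmult S A B))"
    then have "(M A * M B) $$ (i, j) = (\<Sum>k\<in>{0..<m}. A (h i) (h k) * B (h k) (h j))"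
      by (simp add: M_def scalar_prod_def)
    also have "\<dots> = (\<Sum>r\<in>S. A (h i) r * B r (h j))"
      by (rule sum.reindex_bij_betw[OF h])
    finally show "(M A * M B) $$ (i, j) = M (kmult S A B) $$ (i, j)"
      using \<open>i < _\<close> \<open>j < _\<close> by (simp add: M_def kmult_def)
  qed (auto simp: M_def)
  have Mc: "M A \<in> carrier_mat m m" for A by (simp add: M_def)
  have hS: "h i \<in> S" if "i < m" for i using h that by (auto simp: bij_betw_def)
  have Meq: "M A = M B \<longleftrightarrow> (\<forall>s\<in>S. \<forall>t\<in>S. A s t = B s t)" for A B
  proof
    assume eq: "M A = M B"
    have "A (h i) (h j) = B (h i) (h j)" if "i < m" "j < m" for i j
      using arg_cong[OF eq, of "\<lambda>M. M $$ (i, j)"] that by (simp add: M_def)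
    then show "\<forall>s\<in>S. \<forall>t\<in>S. A s t = B s t"
      using h by (force simp: bij_betw_def)
  qed (auto simp: M_def hS intro!: eq_matI)
  have EE: "M E * M E = M E" and UV: "M U * M V = M E"
    by (auto simp: MM Meq E UV)
  have corner: "M E * M A = M A" "M A * M E = M A"
    if "\<And>s t. s \<in> S \<Longrightarrow> t \<in> S \<Longrightarrow> kmult S (kmult S E B) E s t = A s t" for A B
  proof -
    have A: "M A = M E * M B * M E" using that by (simp add: MM Meq)
    have "M E * M A = (M E * M E) * M B * M E"
      using Mc by (simp add: A assoc_mult_mat[of _ m m _ m _ m] mult_carrier_mat[of _ m m _ m])
    then show "M E * M A = M A" by (simp only: EE A)
    have "M A * M E = M E * M B * (M E * M E)"
      using Mc by (simp add: A assoc_mult_mat[of _ m m _ m _ m] mult_carrier_mat[of _ m m _ m])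
    then show "M A * M E = M A" by (simp only: EE A)
  qed
  have "M V * M U = M E"
    by (rule mat_corner_dedekind_finite[OF Mc Mc Mc EE corner[OF U] corner[OF V] UV])
  then show ?thesis using st by (auto simp: MM Meq)
qed

section \<open>Quotients of semigroup algebras\<close>

definition conv :: "('s \<Rightarrow> 's \<Rightarrow> 's) \<Rightarrow> ('s \<Rightarrow>\<^sub>0 'k::comm_ring_1) \<Rightarrow> ('s \<Rightarrow>\<^sub>0 'k) \<Rightarrow> ('s \<Rightarrow>\<^sub>0 'k)" where
  "conv m f g = (\<Sum>s\<in>Poly_Mapping.keys f. \<Sum>t\<in>Poly_Mapping.keys g.
      Poly_Mapping.single (m s t) (Poly_Mapping.lookup f s * Poly_Mapping.lookup g t))"

lemma semigroup_algebra_simps [simp]: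
  "carrier (semigroup_algebra S m) = {f. Poly_Mapping.keys f \<subseteq> S}"
  "f \<otimes>\<^bsub>semigroup_algebra S m\<^esub> g = conv m f g"
  "\<zero>\<^bsub>semigroup_algebra S m\<^esub> = 0"
  "f \<oplus>\<^bsub>semigroup_algebra S m\<^esub> g = f + g"
  "c \<odot>\<^bsub>semigroup_algebra S m\<^esub> f = Poly_Mapping.map ((*) c) f"
  by (simp_all add: semigroup_algebra_def conv_def)

lemma conv_superset:
  assumes "finite S" "finite T" "Poly_Mapping.keys f \<subseteq> S" "Poly_Mapping.keys g \<subseteq> T"
  shows "conv m f g = (\<Sum>s\<in>S. \<Sum>t\<in>T.
      Poly_Mapping.single (m s t) (Poly_Mapping.lookup f s * Poly_Mapping.lookup g t))"
proof -
  have "(\<Sum>t\<in>Poly_Mapping.keys g. Poly_Mapping.single (m s t) (Poly_Mapping.lookup f s * Poly_Mapping.lookup g t))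
      = (\<Sum>t\<in>T. Poly_Mapping.single (m s t) (Poly_Mapping.lookup f s * Poly_Mapping.lookup g t))" for s
    using assms by (intro sum.mono_neutral_left) (auto simp: in_keys_iff)
  then have "conv m f g = (\<Sum>s\<in>Poly_Mapping.keys f. \<Sum>t\<in>T.
      Poly_Mapping.single (m s t) (Poly_Mapping.lookup f s * Poly_Mapping.lookup g t))"
    by (simp add: conv_def)
  also have "\<dots> = (\<Sum>s\<in>S. \<Sum>t\<in>T.
      Poly_Mapping.single (m s t) (Poly_Mapping.lookup f s * Poly_Mapping.lookup g t))"
    using assms by (intro sum.mono_neutral_left) (auto simp: in_keys_iff)
  finally show ?thesis .
qed

lemma conv_add_left: "conv m (f + f') g = conv m f g + conv m f' g"
proof -
  let ?S = "Poly_Mapping.keys f \<union> Poly_Mapping.keys f'"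
  have "Poly_Mapping.keys (f + f') \<subseteq> ?S" by (rule keys_add)
  then show ?thesis
    by (simp add: conv_superset[of ?S "Poly_Mapping.keys g"] lookup_add distrib_right single_add sum.distrib)
qed

lemma conv_add_right: "conv m f (g + g') = conv m f g + conv m f g'"
proof -
  let ?T = "Poly_Mapping.keys g \<union> Poly_Mapping.keys g'"
  have "Poly_Mapping.keys (g + g') \<subseteq> ?T" by (rule keys_add)
  then show ?thesis
    by (simp add: conv_superset[of "Poly_Mapping.keys f" ?T] lookup_add distrib_left single_add sum.distrib)
qed

lemma conv_zero [simp]: "conv m 0 g = 0" "conv m f 0 = 0"
  by (simp_all add: conv_def)

lemma conv_sum_right: "conv m f (\<Sum>i\<in>A. g i) = (\<Sum>i\<in>A. conv m f (g i))"
  by (induction A rule: infinite_finite_induct) (simp_all add: conv_add_right)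

lemma conv_sum_left: "conv m (\<Sum>i\<in>A. f i) g = (\<Sum>i\<in>A. conv m (f i) g)"
  by (induction A rule: infinite_finite_induct) (simp_all add: conv_add_left)

lemma conv_diff_right: "conv m f (g - g') = conv m f g - conv m f g'"
  using conv_add_right[of m f "g - g'" g'] by (simp add: algebra_simps)

lemma conv_diff_left: "conv m (f - f') g = conv m f g - conv m f' g"
  using conv_add_left[of m "f - f'" f' g] by (simp add: algebra_simps)

lemma conv_single [simp]:
  "conv m (Poly_Mapping.single s a) (Poly_Mapping.single t b) = Poly_Mapping.single (m s t) (a * b)"
  by (subst conv_superset[of "{s}" "{t}"]) auto

lemma keys_conv:
  assumes "\<And>s t. s \<in> S \<Longrightarrow> t \<in> S \<Longrightarrow> m s t \<in> S"
    and "Poly_Mapping.keys f \<subseteq> S" "Poly_Mapping.keys g \<subseteq> S"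
  shows "Poly_Mapping.keys (conv m f g) \<subseteq> S"
  unfolding conv_def
  by (intro order_trans[OF keys_sum] UN_least) (use assms in auto)

lemma keys_sum_subset:
  assumes "\<And>i. i \<in> A \<Longrightarrow> Poly_Mapping.keys (f i) \<subseteq> S"
  shows "Poly_Mapping.keys (\<Sum>i\<in>A. f i) \<subseteq> S"
  by (intro order_trans[OF keys_sum] UN_least) (use assms in auto)

lemma sum_single_lookup:
  fixes f :: "'s \<Rightarrow>\<^sub>0 'k::comm_ring_1"
  shows "(\<Sum>s\<in>Poly_Mapping.keys f. Poly_Mapping.single s (Poly_Mapping.lookup f s)) = f"
  by (rule poly_mapping_eqI) (simp add: lookup_sum lookup_single when_def in_keys_iff)

lemma map_times_single [simp]:
  "Poly_Mapping.map ((*) c) (Poly_Mapping.single s (a::'k::comm_ring_1)) = Poly_Mapping.single s (c * a)"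
  by (rule poly_mapping_eqI) (simp add: Poly_Mapping.map.rep_eq lookup_single when_def)

lemma lookup_map_times [simp]:
  "Poly_Mapping.lookup (Poly_Mapping.map ((*) c) f) s = (c::'k::comm_ring_1) * Poly_Mapping.lookup f s"
  by (simp add: Poly_Mapping.map.rep_eq when_def)

lemma keys_map_times:
  fixes f :: "'s \<Rightarrow>\<^sub>0 'k::comm_ring_1"
  shows "Poly_Mapping.keys (Poly_Mapping.map ((*) c) f) \<subseteq> Poly_Mapping.keys f"
  by (auto simp: in_keys_iff)

section \<open>Cosets of an algebra ideal\<close>

locale semigroup_algebra_ideal =
  fixes S :: "'s set" and m :: "'s \<Rightarrow> 's \<Rightarrow> 's" and I :: "('s \<Rightarrow>\<^sub>0 'k::comm_ring_1) set"
  assumes closed: "s \<in> S \<Longrightarrow> t \<in> S \<Longrightarrow> m s t \<in> S"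
    and ideal: "algebra_ideal I (semigroup_algebra S m)"
begin

abbreviation "Q \<equiv> semigroup_algebra S m Quot I"

definition \<pi> :: "('s \<Rightarrow>\<^sub>0 'k) \<Rightarrow> ('s \<Rightarrow>\<^sub>0 'k) set" where
  "\<pi> f = I +>\<^bsub>semigroup_algebra S m\<^esub> f"

lemma I_keys: "f \<in> I \<Longrightarrow> Poly_Mapping.keys f \<subseteq> S"
  using ideal additive_subgroup.a_subset[of I "semigroup_algebra S m"]
  by (auto simp: algebra_ideal_def)

lemma conv_closed:
  assumes "Poly_Mapping.keys f \<subseteq> S" "Poly_Mapping.keys g \<subseteq> S"
  shows "Poly_Mapping.keys (conv m f g) \<subseteq> S"
  by (rule keys_conv[of S m]) (use closed assms in auto)

lemma comm_group: "comm_group (add_monoid (semigroup_algebra S m :: ('k, 's \<Rightarrow>\<^sub>0 'k) module))"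
proof (rule comm_groupI)
  fix x :: "'s \<Rightarrow>\<^sub>0 'k"
  assume x: "x \<in> carrier (add_monoid (semigroup_algebra S m))"
  show "\<exists>y\<in>carrier (add_monoid (semigroup_algebra S m)).
         y \<otimes>\<^bsub>add_monoid (semigroup_algebra S m)\<^esub> x = \<one>\<^bsub>add_monoid (semigroup_algebra S m)\<^esub>"
    by (rule bexI[of _ "-x"]) (use x in \<open>auto \<close>)
qed (auto simp: algebra_simps subset_iff dest: set_mp[OF keys_add])

lemma abelian_subgroup: "abelian_subgroup I (semigroup_algebra S m)"
  by (rule abelian_subgroupI2[OF comm_group])
    (use ideal in \<open>auto simp: algebra_ideal_def additive_subgroup_def\<close>)

sublocale abelian_subgroup I "semigroup_algebra S m"
  by (rule abelian_subgroup)

lemma a_inv_eq: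
  fixes f :: "'s \<Rightarrow>\<^sub>0 'k"
  shows "Poly_Mapping.keys f \<subseteq> S \<Longrightarrow> \<ominus>\<^bsub>semigroup_algebra S m\<^esub> f = - f"
  using minus_equality[of "- f" f] by simp

lemma \<pi>_eq_iff:
  assumes "Poly_Mapping.keys f \<subseteq> S" "Poly_Mapping.keys g \<subseteq> S"
  shows "\<pi> f = \<pi> g \<longleftrightarrow> f - g \<in> I"
proof -
  have "\<pi> f = \<pi> g \<longleftrightarrow> f \<in> I +>\<^bsub>semigroup_algebra S m\<^esub> g"
    unfolding \<pi>_def using assms a_repr_independence'[of f g] a_rcos_self[of f] by auto
  also have "\<dots> \<longleftrightarrow> f - g \<in> I"
    using a_rcos_module[of g f] assms by (simp add: a_inv_eq)
  finally show ?thesis .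
qed

lemma I_mult:
  assumes "f \<in> I" "Poly_Mapping.keys g \<subseteq> S"
  shows "conv m f g \<in> I" "conv m g f \<in> I"
  using ideal assms by (auto simp: algebra_ideal_def)

lemma I_zero: "0 \<in> I" and I_add: "f \<in> I \<Longrightarrow> g \<in> I \<Longrightarrow> f + g \<in> I"
  using additive_subgroup.zero_closed[OF additive_subgroup_axioms]
    additive_subgroup.a_closed[OF additive_subgroup_axioms] by auto

lemma I_uminus: "f \<in> I \<Longrightarrow> - f \<in> I"
  using additive_subgroup.a_inv_closed[OF additive_subgroup_axioms, of f] I_keys[of f] by (auto simp: a_inv_eq)

lemma I_scale: "f \<in> I \<Longrightarrow> Poly_Mapping.map ((*) c) f \<in> I"
  using ideal by (auto simp: algebra_ideal_def)

lemma \<pi>_carrier: "carrier Q = \<pi> ` {f. Poly_Mapping.keys f \<subseteq> S}"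
  by (auto simp: FactRing_def \<pi>_def A_RCOSETS_def')

lemma \<pi>_add:
  assumes "Poly_Mapping.keys f \<subseteq> S" "Poly_Mapping.keys g \<subseteq> S"
  shows "\<pi> f \<oplus>\<^bsub>Q\<^esub> \<pi> g = \<pi> (f + g)"
  using a_rcos_sum[of f g] assms by (simp add: FactRing_def \<pi>_def)

text \<open>The factor ring multiplies two cosets by taking the union of the cosets of all products
  of representatives. The ideal property makes these cosets equal, so the union is just one of
  them.\<close>

lemma \<pi>_mult:
  assumes f: "Poly_Mapping.keys f \<subseteq> S" and g: "Poly_Mapping.keys g \<subseteq> S"
  shows "\<pi> f \<otimes>\<^bsub>Q\<^esub> \<pi> g = \<pi> (conv m f g)"
proof -
  have "\<pi> (conv m a b) = \<pi> (conv m f g)" if "a \<in> \<pi> f" "b \<in> \<pi> g" for a b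
  proof -
    from that obtain i j where ij: "i \<in> I" "a = i + f" "j \<in> I" "b = j + g"
      by (auto simp: \<pi>_def a_r_coset_def')
    then have ks: "Poly_Mapping.keys a \<subseteq> S" "Poly_Mapping.keys b \<subseteq> S"
      using I_keys[of i] I_keys[of j] f g keys_add[of i f] keys_add[of j g] by blast+
    have "conv m a b - conv m f g = conv m i b + conv m f j"
      by (simp add: ij conv_add_left conv_add_right)
    also have "\<dots> \<in> I" by (intro I_add I_mult ij ks f)
    finally show ?thesis
      by (subst \<pi>_eq_iff) (simp_all add: conv_closed ks f g)
  qed
  moreover have "f \<in> \<pi> f" "g \<in> \<pi> g"
    using a_rcos_self[of f] a_rcos_self[of g] f g by (auto simp: \<pi>_def)
  ultimately have "(\<Union>a\<in>\<pi> f. \<Union>b\<in>\<pi> g. \<pi> (conv m a b)) = \<pi> (conv m f g)" by blast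
  then show ?thesis by (simp add: FactRing_def rcoset_mult_def \<pi>_def)
qed

text \<open>This gives the finite sums in the entries of a matrix product over \<open>Q\<close>
  their usual laws.\<close>

lemma abelian_group_Q: "abelian_group Q"
  by (rule comm_group_abelian_groupI)
    (simp add: FactRing_def a_factorgroup_is_comm_group[unfolded A_FactGroup_def'])

lemma finsum_\<pi>:
  assumes "finite K" "\<And>k. k \<in> K \<Longrightarrow> Poly_Mapping.keys (f k) \<subseteq> S"
  shows "(\<Oplus>\<^bsub>Q\<^esub>k\<in>K. \<pi> (f k)) = \<pi> (\<Sum>k\<in>K. f k)"
proof -
  interpret Q: abelian_group Q by (rule abelian_group_Q)
  show ?thesis using assms
  proof (induction K rule: finite_induct)
    case empty
    have "I = \<pi> 0" using a_coset_add_zero[OF a_subset] by (simp add: \<pi>_def)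
    moreover have "\<zero>\<^bsub>Q\<^esub> = I" by (simp add: FactRing_def)
    ultimately show ?case by simp
  next
    case (insert k K)
    then have "(\<Oplus>\<^bsub>Q\<^esub>k\<in>insert k K. \<pi> (f k)) = \<pi> (f k) \<oplus>\<^bsub>Q\<^esub> (\<Oplus>\<^bsub>Q\<^esub>k\<in>K. \<pi> (f k))"
      by (intro Q.finsum_insert) (auto simp: \<pi>_carrier)
    then show ?case
      using insert by (simp add: \<pi>_add keys_sum_subset)
  qed
qed

end

text \<open>Writing corner elements as \<open>e x e\<close> removes the corners, and
  \<open>f\<close> lifts the product along \<open>h\<close>, so that the property speaks of
  representatives and of equality under \<open>h\<close>. It serves for cosets and for matrices of
  cosets alike.\<close>

lemma dedekind_finite_image_iff:
  assumes carrier: "carrier R = h ` C"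
    and mult: "\<And>a b. a \<in> C \<Longrightarrow> b \<in> C \<Longrightarrow> h a \<otimes>\<^bsub>R\<^esub> h b = h (f a b)"
    and closed: "\<And>a b. a \<in> C \<Longrightarrow> b \<in> C \<Longrightarrow> f a b \<in> C"
  shows "dedekind_finite R \<longleftrightarrow> (\<forall>e\<in>C. h (f e e) = h e \<longrightarrow>
    (\<forall>x\<in>C. \<forall>y\<in>C. h (f (f (f e x) e) (f (f e y) e)) = h e \<longrightarrow>
      h (f (f (f e y) e) (f (f e x) e)) = h e))"
proof -
  have "corner R (h e) = (\<lambda>x. h (f (f e x) e)) ` C" if "e \<in> C" for e
  proof -
    have "corner R (h e) = (\<lambda>x. h e \<otimes>\<^bsub>R\<^esub> h x \<otimes>\<^bsub>R\<^esub> h e) ` C"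
      by (auto simp: corner_def carrier)
    also have "\<dots> = (\<lambda>x. h (f (f e x) e)) ` C"
      using that by (intro image_cong refl) (simp add: mult closed)
    finally show ?thesis .
  qed
  then show ?thesis
    by (simp add: dedekind_finite_def carrier mult closed)
qed

section \<open>Matrices over the quotient, by representatives\<close>

context semigroup_algebra_ideal
begin

definition mmult :: "nat \<Rightarrow> (nat \<Rightarrow> nat \<Rightarrow> 's \<Rightarrow>\<^sub>0 'k) \<Rightarrow> (nat \<Rightarrow> nat \<Rightarrow> 's \<Rightarrow>\<^sub>0 'k) \<Rightarrow> nat \<Rightarrow> nat \<Rightarrow> 's \<Rightarrow>\<^sub>0 'k" where
  "mmult n a b = (\<lambda>i j. \<Sum>k<n. conv m (a i k) (b k j))"

definition entries :: "nat \<Rightarrow> (nat \<Rightarrow> nat \<Rightarrow> 's \<Rightarrow>\<^sub>0 'k) \<Rightarrow> ('s \<Rightarrow>\<^sub>0 'k) set" where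
  "entries n a = (\<lambda>(i, j). a i j) ` ({..<n} \<times> {..<n})"

definition qmat :: "nat \<Rightarrow> (nat \<Rightarrow> nat \<Rightarrow> 's \<Rightarrow>\<^sub>0 'k) \<Rightarrow> ('s \<Rightarrow>\<^sub>0 'k) set mat" where
  "qmat n a = mat n n (\<lambda>(i, j). \<pi> (a i j))"

abbreviation over_S :: "nat \<Rightarrow> (nat \<Rightarrow> nat \<Rightarrow> 's \<Rightarrow>\<^sub>0 'k) \<Rightarrow> bool" where
  "over_S n a \<equiv> entries n a \<subseteq> {f. Poly_Mapping.keys f \<subseteq> S}"

lemma over_SD: "over_S n a \<Longrightarrow> i < n \<Longrightarrow> j < n \<Longrightarrow> Poly_Mapping.keys (a i j) \<subseteq> S"
  by (auto simp: entries_def)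

lemma over_S_mmult:
  assumes "over_S n a" "over_S n b" shows "over_S n (mmult n a b)"
proof -
  have "Poly_Mapping.keys (mmult n a b i j) \<subseteq> S" if "i < n" "j < n" for i j
    unfolding mmult_def using that over_SD[OF assms(1)] over_SD[OF assms(2)]
    by (intro keys_sum_subset conv_closed) auto
  then show ?thesis by (auto simp: entries_def)
qed

lemma qmat_mult:
  assumes "over_S n a" "over_S n b"
  shows "qmat n a \<otimes>\<^bsub>matrix_rng n Q\<^esub> qmat n b = qmat n (mmult n a b)"
proof (rule eq_matI)
  fix i j assume "i < dim_row (qmat n (mmult n a b))" "j < dim_col (qmat n (mmult n a b))"
  then have ij: "i < n" "j < n" by (auto simp: qmat_def)
  have "(qmat n a \<otimes>\<^bsub>matrix_rng n Q\<^esub> qmat n b) $$ (i, j)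
      = (\<Oplus>\<^bsub>Q\<^esub>k\<in>{..<n}. qmat n a $$ (i, k) \<otimes>\<^bsub>Q\<^esub> qmat n b $$ (k, j))"
    using ij by (simp add: matrix_rng_def)
  also have "\<dots> = (\<Oplus>\<^bsub>Q\<^esub>k\<in>{..<n}. \<pi> (conv m (a i k) (b k j)))"
  proof -
    interpret Q: abelian_group Q by (rule abelian_group_Q)
    show ?thesis
      using ij over_SD[OF assms(1)] over_SD[OF assms(2)]
      by (intro Q.finsum_cong') (simp_all add: qmat_def \<pi>_mult \<pi>_carrier conv_closed Pi_def)
  qed
  also have "\<dots> = \<pi> (mmult n a b i j)"
    unfolding mmult_def using ij over_SD[OF assms(1)] over_SD[OF assms(2)]
    by (intro finsum_\<pi> conv_closed) auto
  finally show "(qmat n a \<otimes>\<^bsub>matrix_rng n Q\<^esub> qmat n b) $$ (i, j) = qmat n (mmult n a b) $$ (i, j)"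
    using ij by (simp add: qmat_def)
qed (auto simp: matrix_rng_def qmat_def)

lemma qmat_carrier: "carrier (matrix_rng n Q) = qmat n ` {a. over_S n a}"
proof (intro equalityI subsetI)
  fix M assume M: "M \<in> carrier (matrix_rng n Q)"
  define a where "a = (\<lambda>i j. SOME f. Poly_Mapping.keys f \<subseteq> S \<and> M $$ (i, j) = \<pi> f)"
  have a: "Poly_Mapping.keys (a i j) \<subseteq> S \<and> M $$ (i, j) = \<pi> (a i j)" if "i < n" "j < n" for i j
    unfolding a_def by (rule someI_ex) (use M that in \<open>force simp: matrix_rng_def \<pi>_carrier\<close>)
  then have "M = qmat n a" using M by (auto simp: qmat_def matrix_rng_def intro!: eq_matI)
  moreover have "over_S n a" using a by (auto simp: entries_def)
  ultimately show "M \<in> qmat n ` {a. over_S n a}" by blast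
qed (auto simp: qmat_def matrix_rng_def \<pi>_carrier over_SD)

lemma qmat_eq_iff:
  assumes "over_S n a" "over_S n b"
  shows "qmat n a = qmat n b \<longleftrightarrow> (\<forall>i<n. \<forall>j<n. a i j - b i j \<in> I)"
proof -
  have "qmat n a = qmat n b \<longleftrightarrow> (\<forall>i<n. \<forall>j<n. \<pi> (a i j) = \<pi> (b i j))"
    unfolding qmat_def by (auto simp: mat_eq_iff)
  then show ?thesis using \<pi>_eq_iff over_SD[OF assms(1)] over_SD[OF assms(2)] by auto
qed

lemma dedekind_finite_matrix_rng_iff:
  "dedekind_finite (matrix_rng n Q) \<longleftrightarrow> (\<forall>e\<in>{a. over_S n a}. qmat n (mmult n e e) = qmat n e \<longrightarrow>
    (\<forall>x\<in>{a. over_S n a}. \<forall>y\<in>{a. over_S n a}.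
      qmat n (mmult n (mmult n (mmult n e x) e) (mmult n (mmult n e y) e)) = qmat n e \<longrightarrow>
      qmat n (mmult n (mmult n (mmult n e y) e) (mmult n (mmult n e x) e)) = qmat n e))"
  by (rule dedekind_finite_image_iff) (auto simp only: qmat_carrier qmat_mult over_S_mmult mem_Collect_eq)

text \<open>The hypothesis \<open>sep\<close> asks for local matrix representations: additive
  everywhere, multiplicative on products of two members of \<open>Z\<close>, and detecting
  \<open>I\<close> exactly on \<open>Z\<close>. A possible failure involves finitely many
  representatives, so a single such representation carries it over to matrices over
  \<open>K\<close>, where it cannot occur.\<close>

lemma dedekind_finite_matrix_rng:
  assumes sep: "\<And>Z. finite Z \<Longrightarrow> (\<And>f. f \<in> Z \<Longrightarrow> Poly_Mapping.keys f \<subseteq> S) \<Longrightarrow>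
    \<exists>(Y::'y set) (\<kappa>::('s \<Rightarrow>\<^sub>0 'k) \<Rightarrow> 'y \<Rightarrow> 'y \<Rightarrow> 'k). finite Y
      \<and> (\<forall>f g x y. \<kappa> (f + g) x y = \<kappa> f x y + \<kappa> g x y)
      \<and> (\<forall>f\<in>Z. \<forall>g\<in>Z. \<forall>x\<in>Y. \<forall>y\<in>Y. \<kappa> (conv m f g) x y = kmult Y (\<kappa> f) (\<kappa> g) x y)
      \<and> (\<forall>f\<in>Z. f \<in> I \<longleftrightarrow> (\<forall>x\<in>Y. \<forall>y\<in>Y. \<kappa> f x y = 0))"
  shows "dedekind_finite (matrix_rng n Q)"
  unfolding dedekind_finite_matrix_rng_iff
proof (intro ballI impI, goal_cases)
  case (1 e x y)
  have "e \<in> {a. over_S n a}" "x \<in> {a. over_S n a}" "y \<in> {a. over_S n a}" by fact+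
  then have over: "over_S n e" "over_S n x" "over_S n y" by auto
  define u v where "u = mmult n (mmult n e x) e" and "v = mmult n (mmult n e y) e"
  have over': "over_S n u" "over_S n v" by (simp_all add: u_def v_def over over_S_mmult)
  define D where "D = (\<lambda>a b (i::nat) (j::nat). a i j - b i j :: 's \<Rightarrow>\<^sub>0 'k)"
  \<comment> \<open>All factors of products to be evaluated are listed, including the partial
    products with \<open>e\<close>. The differences are listed because their membership in
    \<open>I\<close> expresses equality of cosets and is to be translated through
    \<open>\<kappa>\<close>; the sums of products inside them are reached by additivity.\<close>
  define L where "L = [e, x, y, mmult n e x, mmult n e y, u, v, D (mmult n e e) e, D (mmult n u v) e, D (mmult n v u) e]"
  define Z where "Z = (\<Union>a\<in>set L. entries n a)"
  have "qmat n (mmult n e e) = qmat n e" "qmat n (mmult n u v) = qmat n e"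
    using 1 by (simp_all add: u_def v_def)
  then have I1: "D (mmult n e e) e i j \<in> I" "D (mmult n u v) e i j \<in> I" if "i < n" "j < n" for i j
    using that over over' by (auto simp: qmat_eq_iff over_S_mmult D_def)
  have D: "over_S n (D a b)" if "over_S n a" "over_S n b" for a b
  proof -
    have "Poly_Mapping.keys (a i j - b i j) \<subseteq> S" if "i < n" "j < n" for i j
      using keys_diff[of "a i j" "b i j"] over_SD[OF \<open>over_S n a\<close> that] over_SD[OF \<open>over_S n b\<close> that]
      by (meson Un_least order_trans)
    then show ?thesis by (auto simp only: entries_def D_def case_prod_conv)
  qed
  have "finite Z" by (auto simp: Z_def entries_def)
  moreover have "Poly_Mapping.keys f \<subseteq> S" if "f \<in> Z" for f
  proof -
    have "\<forall>a\<in>set L. over_S n a" by (simp add: L_def over over' D over_S_mmult)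
    then show ?thesis using that unfolding Z_def by blast
  qed
  ultimately obtain Y :: "'y set" and \<kappa> :: "('s \<Rightarrow>\<^sub>0 'k) \<Rightarrow> 'y \<Rightarrow> 'y \<Rightarrow> 'k" where
    Y: "finite Y" and add: "\<And>f g x y. \<kappa> (f + g) x y = \<kappa> f x y + \<kappa> g x y"
    and mult: "\<And>f g x y. f \<in> Z \<Longrightarrow> g \<in> Z \<Longrightarrow> x \<in> Y \<Longrightarrow> y \<in> Y \<Longrightarrow> \<kappa> (conv m f g) x y = kmult Y (\<kappa> f) (\<kappa> g) x y"
    and I: "\<And>f. f \<in> Z \<Longrightarrow> f \<in> I \<longleftrightarrow> (\<forall>x\<in>Y. \<forall>y\<in>Y. \<kappa> f x y = 0)"
    using sep[of Z] by metis
  have \<kappa>0: "\<kappa> 0 x y = 0" for x y using add[of 0 0 x y] by simp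
  have \<kappa>sum: "\<kappa> (\<Sum>i\<in>A. f i) x y = (\<Sum>i\<in>A. \<kappa> (f i) x y)" if "finite A" for f x y and A :: "nat set"
    using that by (induction A rule: finite_induct) (simp_all add: \<kappa>0 add)
  have \<kappa>D: "\<kappa> (D a b i j) x y = \<kappa> (a i j) x y - \<kappa> (b i j) x y" for a b i j x y
    using add[of "D a b i j" "b i j" x y] by (simp add: D_def)
  \<comment> \<open>Block matrices: replacing each entry by its image under \<open>\<kappa>\<close>
    gives a kernel on \<open>T\<close>, so that representations of single elements suffice for
    matrices of every size.\<close>
  define K where "K = (\<lambda>(a :: nat \<Rightarrow> nat \<Rightarrow> 's \<Rightarrow>\<^sub>0 'k) (i, x) (j, y). \<kappa> (a i j) x y)"
  define T where "T = {..<n} \<times> Y"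
  have ZL: "a i j \<in> Z" if "a \<in> set L" "i < n" "j < n" for a i j
    using that unfolding Z_def entries_def by (intro UN_I[of a] image_eqI[of _ _ "(i, j)"]) auto
  have K: "kmult T (K a) (K b) s t = K (mmult n a b) s t"
    if ab: "a \<in> set L" "b \<in> set L" and st: "s \<in> T" "t \<in> T" for a b s t
  proof -
    obtain i x j y where s: "s = (i, x)" "t = (j, y)" "i < n" "j < n" "x \<in> Y" "y \<in> Y"
      using st by (auto simp: T_def)
    have "kmult T (K a) (K b) s t = (\<Sum>k<n. kmult Y (\<kappa> (a i k)) (\<kappa> (b k j)) x y)"
      unfolding kmult_def T_def by (subst sum.cartesian_product) (simp add: K_def s case_prod_unfold)
    also have "\<dots> = (\<Sum>k<n. \<kappa> (conv m (a i k) (b k j)) x y)"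
      by (intro sum.cong refl mult[symmetric]) (use s ab ZL in auto)
    also have "\<dots> = K (mmult n a b) s t"
      by (simp add: mmult_def \<kappa>sum K_def s)
    finally show ?thesis .
  qed
  have KI: "K a s t = K b s t" if Dab: "D a b \<in> set L" and st: "s \<in> T" "t \<in> T"
    and DI: "\<And>i j. i < n \<Longrightarrow> j < n \<Longrightarrow> D a b i j \<in> I" for a b s t
  proof -
    obtain i x j y where s: "s = (i, x)" "t = (j, y)" "i < n" "j < n" "x \<in> Y" "y \<in> Y"
      using st by (auto simp: T_def)
    then have "\<kappa> (D a b i j) x y = 0"
      using I[OF ZL[OF Dab s(3,4)]] DI[OF s(3,4)] by blast
    then show ?thesis by (simp add: K_def s \<kappa>D)
  qed
  have L: "e \<in> set L" "x \<in> set L" "y \<in> set L" "mmult n e x \<in> set L" "mmult n e y \<in> set L"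
    "u \<in> set L" "v \<in> set L" "D (mmult n e e) e \<in> set L" "D (mmult n u v) e \<in> set L"
    "D (mmult n v u) e \<in> set L" by (simp_all add: L_def)
  have cong: "kmult T (kmult T (K e) (K z)) (K e) s t = K (mmult n (mmult n e z) e) s t"
    if "z \<in> set L" "mmult n e z \<in> set L" "s \<in> T" "t \<in> T" for z s t
  proof -
    have "kmult T (kmult T (K e) (K z)) (K e) s t = kmult T (K (mmult n e z)) (K e) s t"
      unfolding kmult_def[of T _ "K e"] using K[OF L(1)] that by (intro sum.cong refl) simp
    then show ?thesis using K[of "mmult n e z" e] that L by simp
  qed
  have VU: "kmult T (K v) (K u) s t = K e s t" if "s \<in> T" "t \<in> T" for s t
  proof (rule kernel_corner_dedekind_finite[where U = "K u" and V = "K v" and E = "K e" and X = "K x" and Y = "K y"])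
    show "finite T" using Y by (simp add: T_def)
  next
    fix s t assume st: "s \<in> T" "t \<in> T"
    show "kmult T (K e) (K e) s t = K e s t"
      using K[OF L(1) L(1) st] KI[OF L(8) st I1(1)] by simp
    show "kmult T (kmult T (K e) (K x)) (K e) s t = K u s t"
      unfolding u_def by (rule cong) (use L st in auto)
    show "kmult T (kmult T (K e) (K y)) (K e) s t = K v s t"
      unfolding v_def by (rule cong) (use L st in auto)
    show "kmult T (K u) (K v) s t = K e s t"
      using K[OF L(6) L(7) st] KI[OF L(9) st I1(2)] by simp
  qed (use that in auto)
  have "D (mmult n v u) e i j \<in> I" if ij: "i < n" "j < n" for i j
  proof (subst I[OF ZL[OF L(10) ij]], intro ballI)
    fix x y assume "x \<in> Y" "y \<in> Y"
    then have T: "(i, x) \<in> T" "(j, y) \<in> T" using ij by (auto simp: T_def)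
    have "K (mmult n v u) (i, x) (j, y) = K e (i, x) (j, y)"
      using VU[OF T] K[OF L(7) L(6) T] by simp
    then show "\<kappa> (D (mmult n v u) e i j) x y = 0" by (simp add: K_def \<kappa>D)
  qed
  then show ?case
    unfolding u_def[symmetric] v_def[symmetric]
    using over over' by (subst qmat_eq_iff) (auto simp: over_S_mmult D_def)
qed

lemma dedekind_finite_iff:
  "dedekind_finite Q \<longleftrightarrow> (\<forall>e\<in>{f. Poly_Mapping.keys f \<subseteq> S}. \<pi> (conv m e e) = \<pi> e \<longrightarrow>
    (\<forall>x\<in>{f. Poly_Mapping.keys f \<subseteq> S}. \<forall>y\<in>{f. Poly_Mapping.keys f \<subseteq> S}.
      \<pi> (conv m (conv m (conv m e x) e) (conv m (conv m e y) e)) = \<pi> e \<longrightarrow>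
      \<pi> (conv m (conv m (conv m e y) e) (conv m (conv m e x) e)) = \<pi> e))"
  by (rule dedekind_finite_image_iff) (simp_all add: \<pi>_carrier \<pi>_mult conv_closed)

text \<open>A matrix of size \<open>1\<close> is the same as its single entry; constant functions
  represent such matrices because only the index pair \<open>(0, 0)\<close> counts.\<close>

lemma dedekind_finite_of_matrix_rng:
  assumes "dedekind_finite (matrix_rng 1 Q)" shows "dedekind_finite Q"
proof -
  have 1: "over_S 1 (\<lambda>_ _. f) \<longleftrightarrow> Poly_Mapping.keys f \<subseteq> S" for f
    by (auto simp: entries_def)
  have 2: "mmult 1 (\<lambda>_ _. f) (\<lambda>_ _. g) = (\<lambda>_ _. conv m f g)" for f g
    by (simp add: mmult_def)
  have 3: "qmat 1 (\<lambda>_ _. f) = qmat 1 (\<lambda>_ _. g) \<longleftrightarrow> \<pi> f = \<pi> g" for f g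
    by (auto simp: qmat_def mat_eq_iff)
  have "\<pi> (conv m (conv m (conv m e y) e) (conv m (conv m e x) e)) = \<pi> e"
    if "Poly_Mapping.keys e \<subseteq> S" "Poly_Mapping.keys x \<subseteq> S" "Poly_Mapping.keys y \<subseteq> S"
      "\<pi> (conv m e e) = \<pi> e"
      "\<pi> (conv m (conv m (conv m e x) e) (conv m (conv m e y) e)) = \<pi> e" for e x y
    by (rule assms[unfolded dedekind_finite_matrix_rng_iff, rule_format,
        of "\<lambda>_ _. e" "\<lambda>_ _. x" "\<lambda>_ _. y", unfolded mem_Collect_eq 1 2 3, OF that(1,4,2,3,5)])
  then show ?thesis by (simp add: dedekind_finite_iff)
qed

end

section \<open>The graph inverse semigroup\<close>

context wf_digraph
begin

lemma paths_iff: "(u, es) \<in> paths G \<longleftrightarrow> awalk u es (path_end G (u, es))"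
  by (auto simp: paths_def path_end_def)

lemma paths_append_iff:
  "(u, es @ xs) \<in> paths G \<longleftrightarrow> (u, es) \<in> paths G \<and> (path_end G (u, es), xs) \<in> paths G"
  by (auto simp: paths_def path_end_def)

lemma path_end_append: "path_end G (u, es @ xs) = path_end G (path_end G (u, es), xs)"
  by (simp add: path_end_def awlast_append)

lemma path_end_Nil [simp]: "path_end G (u, []) = u"
  by (simp add: path_end_def)

lemma path_end_Cons [simp]: "path_end G (u, e # es) = path_end G (head G e, es)"
  by (simp add: path_end_def)

lemma paths_Nil_iff [simp]: "(u, []) \<in> paths G \<longleftrightarrow> u \<in> verts G"
  by (simp add: paths_iff awalk_Nil_iff)

lemma paths_Cons_iff [simp]:
  "(u, e # es) \<in> paths G \<longleftrightarrow> e \<in> arcs G \<and> u = tail G e \<and> (head G e, es) \<in> paths G"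
  by (auto simp: paths_iff awalk_Cons_iff)

lemma path_end_in_verts: "p \<in> paths G \<Longrightarrow> path_end G p \<in> verts G"
  by (cases p) (auto simp: paths_iff)

lemma path_arcs: "(u, es) \<in> paths G \<Longrightarrow> set es \<subseteq> arcs G"
  by (auto simp: paths_iff)

section \<open>Products in the graph inverse semigroup\<close>

lemma mem_path_star:
  "((v', a), (u', b)) \<in> path_star G (u, es) (v, fs) \<longleftrightarrow>
    v' = v \<and> u' = u \<and> (\<exists>xs. a = fs @ xs \<and> b = es @ xs \<and> (path_end G (v, fs), xs) \<in> paths G)"
  by (auto simp: path_star_def path_append_def)

abbreviation PS :: "('a, 'b) path_map set" where
  "PS \<equiv> graph_inverse_semigroup G"

lemma path_star_in_PS:
  "p \<in> paths G \<Longrightarrow> q \<in> paths G \<Longrightarrow> path_end G p = path_end G q \<Longrightarrow> path_star G p q \<in> PS"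
  unfolding graph_inverse_semigroup_def by blast

lemma PS_cases:
  assumes "s \<in> PS"
  obtains "s = {}" | u es v fs where "s = path_star G (u, es) (v, fs)" "(u, es) \<in> paths G"
    "(v, fs) \<in> paths G" "path_end G (u, es) = path_end G (v, fs)"
proof (cases "s = {}")
  case False
  then obtain p q where "s = path_star G p q" "p \<in> paths G" "q \<in> paths G" "path_end G p = path_end G q"
    using assms unfolding graph_inverse_semigroup_def by blast
  then show thesis using that(2)[of "fst p" "snd p" "fst q" "snd q"] by simp
qed

text \<open>This is the rule \<open>pq\<^sup>* (qy)r\<^sup>* = (py)r\<^sup>*\<close>, and the next
  lemma is \<open>p(qy)\<^sup>* qr\<^sup>* = p(ry)\<^sup>*\<close>. If neither of the two middle
  paths extends the other, the product is the empty map.\<close>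

lemma path_star_comp:
  assumes "(v, fs @ ys) \<in> paths G" "path_end G (v, fs @ ys) = path_end G (w, gs)"
  shows "pm_comp (path_star G (u, es) (v, fs)) (path_star G (v, fs @ ys) (w, gs))
    = path_star G (u, es @ ys) (w, gs)"
proof (rule Set.set_eqI)
  fix x :: "('a, 'b) path \<times> ('a, 'b) path"
  obtain a1 a2 b1 b2 where x: "x = ((a1, a2), (b1, b2))" by (metis surj_pair)
  show "x \<in> pm_comp (path_star G (u, es) (v, fs)) (path_star G (v, fs @ ys) (w, gs))
      \<longleftrightarrow> x \<in> path_star G (u, es @ ys) (w, gs)"
    using assms unfolding x pm_comp_def relcomp_unfold
    by (auto simp: mem_path_star paths_append_iff path_end_append)
qed

lemma path_star_comp':
  assumes "(v, fs @ ys) \<in> paths G" "path_end G (v, fs) = path_end G (w, gs)"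
  shows "pm_comp (path_star G (u, es) (v, fs @ ys)) (path_star G (v, fs) (w, gs))
    = path_star G (u, es) (w, gs @ ys)"
proof (rule Set.set_eqI)
  fix x :: "('a, 'b) path \<times> ('a, 'b) path"
  obtain a1 a2 b1 b2 where x: "x = ((a1, a2), (b1, b2))" by (metis surj_pair)
  show "x \<in> pm_comp (path_star G (u, es) (v, fs @ ys)) (path_star G (v, fs) (w, gs))
      \<longleftrightarrow> x \<in> path_star G (u, es) (w, gs @ ys)"
    using assms unfolding x pm_comp_def relcomp_unfold
    by (auto simp: mem_path_star paths_append_iff path_end_append)
qed

lemma path_star_comp_incomparable:
  assumes "\<not> (v = v' \<and> (\<exists>ys. fs' = fs @ ys \<or> fs = fs' @ ys))"
  shows "pm_comp (path_star G p (v, fs)) (path_star G (v', fs') q) = {}"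
  using assms
  by (cases p; cases q) (force simp: pm_comp_def mem_path_star append_eq_append_conv2)

lemma PS_closed:
  assumes "s \<in> PS" "t \<in> PS" shows "pm_comp s t \<in> PS"
proof (cases "s = {} \<or> t = {}")
  case True
  then show ?thesis by (auto simp: pm_comp_def graph_inverse_semigroup_def)
next
  case False
  obtain u es v fs where s: "s = path_star G (u, es) (v, fs)" "(u, es) \<in> paths G"
    "(v, fs) \<in> paths G" "path_end G (u, es) = path_end G (v, fs)"
    using assms(1) False by (blast elim: PS_cases)
  obtain v' fs' w gs where t: "t = path_star G (v', fs') (w, gs)" "(v', fs') \<in> paths G"
    "(w, gs) \<in> paths G" "path_end G (v', fs') = path_end G (w, gs)"
    using assms(2) False by (blast elim: PS_cases)
  show ?thesis
  proof (cases "v = v' \<and> (\<exists>ys. fs' = fs @ ys \<or> fs = fs' @ ys)")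
    case False
    then show ?thesis
      unfolding s t by (subst path_star_comp_incomparable) (auto simp: graph_inverse_semigroup_def)
  next
    case True
    then obtain ys where "v' = v" and "fs' = fs @ ys \<or> fs = fs' @ ys" by blast
    from this(2) show ?thesis
    proof
      assume "fs' = fs @ ys"
      then show ?thesis
        using s t \<open>v' = v\<close> by (auto simp: path_star_comp paths_append_iff path_end_append intro!: path_star_in_PS)
    next
      assume "fs = fs' @ ys"
      then show ?thesis
        using s t \<open>v' = v\<close> by (auto simp: path_star_comp' paths_append_iff path_end_append intro!: path_star_in_PS)
    qed
  qed
qed

lemma PS_paths:
  assumes "s \<in> PS" "((u, a), (v, b)) \<in> s"
  shows "(u, a) \<in> paths G" "(v, b) \<in> paths G" "path_end G (u, a) = path_end G (v, b)"
  using assms(1)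
  by (rule PS_cases; use assms(2) in \<open>auto simp: mem_path_star paths_append_iff path_end_append\<close>)+

lemma PS_extend:
  assumes "s \<in> PS" "((u, a), (v, b)) \<in> s" "(path_end G (u, a), xs) \<in> paths G"
  shows "((u, a @ xs), (v, b @ xs)) \<in> s"
  using assms(1)
  by (rule PS_cases) (use assms(2,3) in \<open>auto simp: mem_path_star paths_append_iff path_end_append\<close>)

lemma PS_inj:
  assumes "s \<in> PS" "(x, z) \<in> s" "(y, z) \<in> s" shows "x = y"
proof -
  obtain x1 x2 y1 y2 z1 z2 where "x = (x1, x2)" "y = (y1, y2)" "z = (z1, z2)" by (metis surj_pair)
  with assms show ?thesis by (elim PS_cases) (auto simp: mem_path_star)
qed

text \<open>
  Products of such elements can be computed with paths over \<open>F\<close> alone: an intermediate path between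
  two paths over \<open>F\<close> is again one.
\<close>

definition arcs_balanced :: "'b set \<Rightarrow> ('a, 'b) path_map \<Rightarrow> bool" where
  "arcs_balanced F s \<longleftrightarrow> (\<forall>(a, b) \<in> s. set (snd a) \<subseteq> F \<longleftrightarrow> set (snd b) \<subseteq> F)"

text \<open>Argument \<open>qx\<close> and value \<open>px\<close> share the tail \<open>x\<close>,
  so with \<open>p\<close> and \<open>q\<close> over \<open>F\<close> each of them is over
  \<open>F\<close> exactly if \<open>x\<close> is.\<close>

lemma arcs_balanced_path_star:
  assumes "set (snd p) \<subseteq> F" "set (snd q) \<subseteq> F"
  shows "arcs_balanced F (path_star G p q)"
  using assms by (auto simp: arcs_balanced_def path_star_def path_append_def)

lemma eventually_arcs_balanced:
  assumes "s \<in> PS"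
  shows "\<forall>\<^sub>F F in finite_subsets_at_top (arcs G). arcs_balanced F s"
  using assms
proof (rule PS_cases)
  fix u es v fs
  assume s: "s = path_star G (u, es) (v, fs)" "(u, es) \<in> paths G" "(v, fs) \<in> paths G"
  show ?thesis
    unfolding eventually_finite_subsets_at_top s(1)
    using path_arcs[OF s(2)] path_arcs[OF s(3)]
    by (intro exI[of _ "set es \<union> set fs"]) (auto intro!: arcs_balanced_path_star)
qed (simp add: arcs_balanced_def)

end

section \<open>Branching systems\<close>

text \<open>
  Membership in the ideal of Leavitt relations is witnessed by finitely many arcs, so it suffices to
  represent a finite set \<open>F\<close> of arcs, with the Cuntz--Krieger relation required only at the vertices
  all of whose arcs lie in \<open>F\<close>.
\<close>

locale branching_system = wf_digraph G for G :: "('a, 'b) pre_digraph" +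
  fixes F :: "'b set" and D :: "'a \<Rightarrow> 'y set" and g :: "'b \<Rightarrow> 'y \<Rightarrow> 'y"
  assumes F_arcs: "F \<subseteq> arcs G"
    and D_disjoint: "y \<in> D u \<Longrightarrow> y \<in> D v \<Longrightarrow> u = v"
    and g_in: "e \<in> F \<Longrightarrow> y \<in> D (head G e) \<Longrightarrow> g e y \<in> D (tail G e)"
    and g_inj: "e \<in> F \<Longrightarrow> e' \<in> F \<Longrightarrow> y \<in> D (head G e) \<Longrightarrow> y' \<in> D (head G e') \<Longrightarrow>
      g e y = g e' y' \<Longrightarrow> e = e' \<and> y = y'"
    and D_cover: "regular_vertex G v \<Longrightarrow> out_arcs G v \<subseteq> F \<Longrightarrow> y \<in> D v \<Longrightarrow>
      \<exists>e\<in>out_arcs G v. \<exists>z\<in>D (head G e). y = g e z"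
begin

lemma foldr_in:
  "(u, es) \<in> paths G \<Longrightarrow> set es \<subseteq> F \<Longrightarrow> z \<in> D (path_end G (u, es)) \<Longrightarrow> foldr g es z \<in> D u"
  by (induction es arbitrary: u) (auto intro: g_in)

text \<open>Arcs act injectively with disjoint images, so a point determines the arcs along which it
  is reached. Two descriptions of one point agree until one of them stops, and the rest of the
  longer path connects the two base points.\<close>

lemma foldr_comparable:
  assumes "(u, es) \<in> paths G" "(v, fs) \<in> paths G" "set es \<subseteq> F" "set fs \<subseteq> F"
    and "z \<in> D (path_end G (u, es))" "z' \<in> D (path_end G (v, fs))"
    and "foldr g es z = foldr g fs z'"
  shows "u = v \<and> (\<exists>xs. fs = es @ xs \<and> z = foldr g xs z' \<or> es = fs @ xs \<and> z' = foldr g xs z)"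
proof -
  have "u = v"
    using foldr_in[OF assms(1,3,5)] foldr_in[OF assms(2,4,6)] assms(7) D_disjoint by metis
  moreover have "\<exists>xs. fs = es @ xs \<and> z = foldr g xs z' \<or> es = fs @ xs \<and> z' = foldr g xs z"
    using assms
  proof (induction es arbitrary: u v fs)
    case (Cons e es)
    show ?case
    proof (cases fs)
      case Nil
      then show ?thesis using Cons.prems by auto
    next
      case fs: (Cons f fs')
      have "e = f \<and> foldr g es z = foldr g fs' z'"
        using Cons.prems by (intro g_inj) (auto simp: fs intro!: foldr_in)
      moreover have "\<exists>xs. fs' = es @ xs \<and> z = foldr g xs z' \<or> es = fs' @ xs \<and> z' = foldr g xs z"
        by (rule Cons.IH[of "head G e" "head G f"]) (use Cons.prems calculation in \<open>auto simp: fs\<close>)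
      ultimately show ?thesis by (auto simp: fs)
    qed
  qed auto
  ultimately show ?thesis by blast
qed

text \<open>The partial bijection of points belonging to \<open>s\<close>: each pair of paths
  \<open>(a, b)\<close> over \<open>F\<close> contributes \<open>az \<mapsto> bz\<close>. It is read
  off from the map \<open>s\<close> itself, so no presentation \<open>pq\<^sup>*\<close> has to be
  chosen.\<close>

definition act :: "('a, 'b) path_map \<Rightarrow> ('y \<times> 'y) set" where
  "act s = {(foldr g a z, foldr g b z) | u a v b z.
     ((u, a), (v, b)) \<in> s \<and> set a \<subseteq> F \<and> set b \<subseteq> F \<and> z \<in> D (path_end G (u, a))}"

lemma actI:
  assumes "((u, a), (v, b)) \<in> s" "set a \<subseteq> F" "set b \<subseteq> F" "z \<in> D (path_end G (u, a))"
    "x = foldr g a z" "y = foldr g b z"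
  shows "(x, y) \<in> act s"
  unfolding act_def using assms by blast

lemma actE:
  assumes "(x, y) \<in> act s"
  obtains u a v b z where "((u, a), (v, b)) \<in> s" "set a \<subseteq> F" "set b \<subseteq> F"
    "z \<in> D (path_end G (u, a))" "x = foldr g a z" "y = foldr g b z"
  using assms by (auto simp: act_def)

lemma act_empty [simp]: "act {} = {}"
  by (simp add: act_def)

text \<open>The preimage is the one that has to be unique, since functions will be transported by
  \<open>(T s h) y = h x\<close>. Two descriptions of \<open>y\<close> are comparable; extending the
  shorter one inside \<open>s\<close> makes the value paths equal, and \<open>s\<close> is
  injective.\<close>

lemma act_functional:
  assumes s: "s \<in> PS" and "(x, y) \<in> act s" "(x', y) \<in> act s"
  shows "x = x'"
proof -
  obtain u a v b z where 1: "((u, a), (v, b)) \<in> s" "set a \<subseteq> F" "set b \<subseteq> F"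
    "z \<in> D (path_end G (u, a))" "x = foldr g a z" "y = foldr g b z"
    using assms(2) by (rule actE)
  obtain u' a' v' b' z' where 2: "((u', a'), (v', b')) \<in> s" "set a' \<subseteq> F" "set b' \<subseteq> F"
    "z' \<in> D (path_end G (u', a'))" "x' = foldr g a' z'" "y = foldr g b' z'"
    using assms(3) by (rule actE)
  note P = PS_paths[OF s 1(1)] PS_paths[OF s 2(1)]
  have "v = v' \<and> (\<exists>xs. b' = b @ xs \<and> z = foldr g xs z' \<or> b = b' @ xs \<and> z' = foldr g xs z)"
    by (rule foldr_comparable) (use P 1 2 in auto)
  then obtain xs where "v' = v" and "b' = b @ xs \<and> z = foldr g xs z' \<or> b = b' @ xs \<and> z' = foldr g xs z"
    by blast
  from this(2) show ?thesis
  proof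
    assume *: "b' = b @ xs \<and> z = foldr g xs z'"
    have "((u, a @ xs), (v, b @ xs)) \<in> s"
      by (rule PS_extend[OF s 1(1)]) (use P * \<open>v' = v\<close> in \<open>auto simp: paths_append_iff\<close>)
    then have "(u', a') = (u, a @ xs)" using PS_inj[OF s, of _ "(v, b @ xs)"] 2(1) * \<open>v' = v\<close> by blast
    then show ?thesis using 1 2 * by simp
  next
    assume *: "b = b' @ xs \<and> z' = foldr g xs z"
    have "((u', a' @ xs), (v', b' @ xs)) \<in> s"
      by (rule PS_extend[OF s 2(1)]) (use P * \<open>v' = v\<close> in \<open>auto simp: paths_append_iff\<close>)
    then have "(u, a) = (u', a' @ xs)" using PS_inj[OF s, of _ "(v, b' @ xs)"] 1(1) * \<open>v' = v\<close> by blast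
    then show ?thesis using 1 2 * by simp
  qed
qed

text \<open>Balancedness keeps the middle path over \<open>F\<close>, where \<open>g\<close> is
  under control. Conversely, a common middle point has two comparable descriptions, and extending
  the shorter one makes the two pairs of paths composable.\<close>

lemma act_comp:
  assumes s: "s \<in> PS" "arcs_balanced F s" and t: "t \<in> PS" "arcs_balanced F t"
  shows "act (pm_comp s t) = act t O act s"
proof (intro equalityI subrelI)
  fix x y assume "(x, y) \<in> act (pm_comp s t)"
  then obtain u a w c z where 1: "((u, a), (w, c)) \<in> pm_comp s t" "set a \<subseteq> F" "set c \<subseteq> F"
    "z \<in> D (path_end G (u, a))" "x = foldr g a z" "y = foldr g c z" by (rule actE)
  then obtain v b where b: "((u, a), (v, b)) \<in> t" "((v, b), (w, c)) \<in> s"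
    by (auto simp: pm_comp_def)
  then have "set b \<subseteq> F" using t(2) 1(2) by (fastforce simp: arcs_balanced_def)
  then have "(x, foldr g b z) \<in> act t" "(foldr g b z, y) \<in> act s"
    using b 1 PS_paths(3)[OF t(1) b(1)] by (auto intro: actI)
  then show "(x, y) \<in> act t O act s" by blast
next
  fix x y assume "(x, y) \<in> act t O act s"
  then obtain w where "(x, w) \<in> act t" "(w, y) \<in> act s" by blast
  obtain u a v b z where 1: "((u, a), (v, b)) \<in> t" "set a \<subseteq> F" "set b \<subseteq> F"
    "z \<in> D (path_end G (u, a))" "x = foldr g a z" "w = foldr g b z"
    using \<open>(x, w) \<in> act t\<close> by (rule actE)
  obtain v' b' k c z' where 2: "((v', b'), (k, c)) \<in> s" "set b' \<subseteq> F" "set c \<subseteq> F"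
    "z' \<in> D (path_end G (v', b'))" "w = foldr g b' z'" "y = foldr g c z'"
    using \<open>(w, y) \<in> act s\<close> by (rule actE)
  note P = PS_paths[OF t(1) 1(1)] PS_paths[OF s(1) 2(1)]
  have "v = v' \<and> (\<exists>xs. b' = b @ xs \<and> z = foldr g xs z' \<or> b = b' @ xs \<and> z' = foldr g xs z)"
    by (rule foldr_comparable) (use P 1 2 in auto)
  then obtain xs where "v' = v" and "b' = b @ xs \<and> z = foldr g xs z' \<or> b = b' @ xs \<and> z' = foldr g xs z"
    by blast
  from this(2) show "(x, y) \<in> act (pm_comp s t)"
  proof
    assume *: "b' = b @ xs \<and> z = foldr g xs z'"
    have "((u, a @ xs), (v, b @ xs)) \<in> t"
      by (rule PS_extend[OF t(1) 1(1)]) (use P * \<open>v' = v\<close> in \<open>auto simp: paths_append_iff\<close>)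
    then have "((u, a @ xs), (k, c)) \<in> pm_comp s t" using 2(1) * \<open>v' = v\<close> by (auto simp: pm_comp_def)
    then show ?thesis
      by (rule actI[where z = z']) (use 1 2 * P \<open>v' = v\<close> in \<open>auto simp: path_end_append\<close>)
  next
    assume *: "b = b' @ xs \<and> z' = foldr g xs z"
    have "((v', b' @ xs), (k, c @ xs)) \<in> s"
      by (rule PS_extend[OF s(1) 2(1)]) (use P * \<open>v' = v\<close> in \<open>auto simp: paths_append_iff\<close>)
    then have "((u, a), (k, c @ xs)) \<in> pm_comp s t" using 1(1) * \<open>v' = v\<close> by (auto simp: pm_comp_def)
    then show ?thesis
      by (rule actI[where z = z]) (use 1 2 * P \<open>v' = v\<close> in \<open>auto simp: path_end_append\<close>)
  qed
qed

lemma act_path_star: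
  assumes "(u, es) \<in> paths G" "(v, fs) \<in> paths G" "path_end G (u, es) = path_end G (v, fs)"
    and "set es \<subseteq> F" "set fs \<subseteq> F"
  shows "act (path_star G (u, es) (v, fs))
    = {(foldr g fs z, foldr g es z) | z. z \<in> D (path_end G (v, fs))}"
proof (intro equalityI subrelI)
  fix x y assume "(x, y) \<in> act (path_star G (u, es) (v, fs))"
  then obtain xs z where "x = foldr g fs (foldr g xs z)" "y = foldr g es (foldr g xs z)"
    "(path_end G (v, fs), xs) \<in> paths G" "set xs \<subseteq> F" "z \<in> D (path_end G (v, fs @ xs))"
    by (elim actE) (auto simp: mem_path_star)
  then show "(x, y) \<in> {(foldr g fs z, foldr g es z) | z. z \<in> D (path_end G (v, fs))}"
    by (auto simp: path_end_append intro!: exI[of _ "foldr g xs z"] foldr_in)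
next
  fix x y assume "(x, y) \<in> {(foldr g fs z, foldr g es z) | z. z \<in> D (path_end G (v, fs))}"
  then obtain z where z: "x = foldr g fs z" "y = foldr g es z" "z \<in> D (path_end G (v, fs))" by blast
  have "((v, fs), (u, es)) \<in> path_star G (u, es) (v, fs)"
    using assms(2) by (simp add: mem_path_star path_end_in_verts)
  then show "(x, y) \<in> act (path_star G (u, es) (v, fs))"
    by (rule actI) (use z assms in auto)
qed

lemma act_vertex_elem: "v \<in> verts G \<Longrightarrow> act (vertex_elem G v) = Id_on (D v)"
  by (auto simp: vertex_elem_def act_path_star)

lemma act_edge_proj: "e \<in> F \<Longrightarrow> act (edge_proj G e) = Id_on (g e ` D (head G e))"
  using F_arcs by (auto simp: edge_proj_def act_path_star subset_iff)

text \<open>Pushforward of functions along the partial bijection, extended by \<open>0\<close> off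
  its image. With this direction \<open>T\<close> turns products into compositions in the same
  order.\<close>

definition T :: "('a, 'b) path_map \<Rightarrow> ('y \<Rightarrow> 'k::comm_ring_1) \<Rightarrow> 'y \<Rightarrow> 'k" where
  "T s h y = (if \<exists>x. (x, y) \<in> act s then h (THE x. (x, y) \<in> act s) else 0)"

lemma T_eq: "s \<in> PS \<Longrightarrow> (x, y) \<in> act s \<Longrightarrow> T s h y = h x"
  unfolding T_def using act_functional by (metis (no_types, lifting) the_equality)

lemma T_eq_0: "(\<And>x. (x, y) \<notin> act s) \<Longrightarrow> T s h y = 0"
  by (simp add: T_def)

lemma T_sum: "T s (\<lambda>x. \<Sum>i\<in>A. c i * h i x) y = (\<Sum>i\<in>A. c i * T s (h i) y)"
  by (simp add: T_def)

lemma T_zero [simp]: "T s (\<lambda>_. 0) y = 0"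
  by (simp add: T_def)

lemma T_comp:
  assumes s: "s \<in> PS" "arcs_balanced F s" and t: "t \<in> PS" "arcs_balanced F t"
  shows "T (pm_comp s t) h y = T s (T t h) y"
proof (cases "\<exists>w. (w, y) \<in> act s")
  case True
  then obtain w where w: "(w, y) \<in> act s" by blast
  show ?thesis
  proof (cases "\<exists>x. (x, w) \<in> act t")
    case True
    then obtain x where x: "(x, w) \<in> act t" by blast
    then have "(x, y) \<in> act (pm_comp s t)" using w act_comp[OF s t] by blast
    then show ?thesis using w x s t by (simp add: T_eq PS_closed)
  next
    case False
    then have "(x, y) \<notin> act (pm_comp s t)" for x
      using w act_functional[OF s(1) w] act_comp[OF s t] by blast
    then show ?thesis using False w s by (simp add: T_eq T_eq_0)
  qed
next
  case False
  then have "(x, y) \<notin> act (pm_comp s t)" for x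
    using act_comp[OF s t] by blast
  then show ?thesis using False by (simp add: T_eq_0)
qed

definition rho :: "(('a, 'b) path_map \<Rightarrow>\<^sub>0 'k::comm_ring_1) \<Rightarrow> ('y \<Rightarrow> 'k) \<Rightarrow> 'y \<Rightarrow> 'k" where
  "rho f h y = (\<Sum>s\<in>Poly_Mapping.keys f. Poly_Mapping.lookup f s * T s h y)"

lemma rho_superset:
  assumes "finite S" "Poly_Mapping.keys f \<subseteq> S"
  shows "rho f h y = (\<Sum>s\<in>S. Poly_Mapping.lookup f s * T s h y)"
  unfolding rho_def using assms by (intro sum.mono_neutral_left) (auto simp: in_keys_iff)

lemma rho_add: "rho (f + f') h y = rho f h y + rho f' h y"
  using keys_add[of f f']
  by (simp add: rho_superset[of "Poly_Mapping.keys f \<union> Poly_Mapping.keys f'"]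
      lookup_add distrib_right sum.distrib)

lemma rho_single: "rho (Poly_Mapping.single s c) h y = c * T s h y"
  by (subst rho_superset[of "{s}"]) auto

lemma rho_zero [simp]: "rho 0 h y = 0"
  by (simp add: rho_def)

lemma rho_zero_right [simp]: "rho f (\<lambda>_. 0) y = 0"
  by (simp add: rho_def)

lemma rho_sum: "rho (\<Sum>i\<in>A. f i) h y = (\<Sum>i\<in>A. rho (f i) h y)"
  by (induction A rule: infinite_finite_induct) (simp_all add: rho_add)

lemma rho_diff: "rho (f - f') h y = rho f h y - rho f' h y"
  using rho_add[of "f - f'" f' h y] by simp

lemma rho_uminus: "rho (- f) h y = - rho f h y"
  using rho_diff[of 0 f h y] by simp

lemma rho_scale: "rho (Poly_Mapping.map ((*) c) f) h y = c * rho f h y"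
  using keys_map_times[of c f]
  by (simp add: rho_superset[of "Poly_Mapping.keys f"] sum_distrib_left mult.assoc)

lemma rho_conv:
  assumes f: "Poly_Mapping.keys f \<subseteq> {s \<in> PS. arcs_balanced F s}"
    and f': "Poly_Mapping.keys f' \<subseteq> {s \<in> PS. arcs_balanced F s}"
  shows "rho (conv pm_comp f f') h y = rho f (rho f' h) y"
proof -
  have "rho (conv pm_comp f f') h y = (\<Sum>s\<in>Poly_Mapping.keys f. \<Sum>t\<in>Poly_Mapping.keys f'.
      Poly_Mapping.lookup f s * Poly_Mapping.lookup f' t * T (pm_comp s t) h y)"
    by (simp add: conv_def rho_sum rho_single)
  also have "\<dots> = (\<Sum>s\<in>Poly_Mapping.keys f. \<Sum>t\<in>Poly_Mapping.keys f'.
      Poly_Mapping.lookup f s * Poly_Mapping.lookup f' t * T s (T t h) y)"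
    using f f' by (intro sum.cong refl) (simp add: T_comp subset_iff)
  also have "\<dots> = rho f (rho f' h) y"
    unfolding rho_def T_sum by (simp add: rho_def[abs_def] T_sum sum_distrib_left mult.assoc)
  finally show ?thesis .
qed

text \<open>The images of the arcs at \<open>v\<close> partition \<open>D v\<close>: they cover it
  by \<open>D_cover\<close> and are disjoint by \<open>g_inj\<close>. Thus a point over
  \<open>v\<close> contributes to exactly one summand and any other point to none.\<close>

lemma rho_relator:
  assumes v: "regular_vertex G v" "out_arcs G v \<subseteq> F"
  shows "rho (Poly_Mapping.single (vertex_elem G v) 1
    - (\<Sum>e\<in>out_arcs G v. Poly_Mapping.single (edge_proj G e) 1)) h y = 0"
proof -
  have V: "v \<in> verts G" and fin: "finite (out_arcs G v)" using v by (auto simp: regular_vertex_def)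
  have PSv: "vertex_elem G v \<in> PS" "\<And>e. e \<in> F \<Longrightarrow> edge_proj G e \<in> PS"
    using V F_arcs by (auto simp: vertex_elem_def edge_proj_def intro!: path_star_in_PS)
  have e: "T (edge_proj G e) h y = (if y \<in> g e ` D (head G e) then h y else 0)" if "e \<in> F" for e
    using that by (auto intro!: T_eq T_eq_0 PSv simp: act_edge_proj simp del: image_iff)
  have "(\<Sum>e\<in>out_arcs G v. T (edge_proj G e) h y) = T (vertex_elem G v) h y"
  proof (cases "y \<in> D v")
    case True
    then obtain e0 where e0: "e0 \<in> out_arcs G v" "y \<in> g e0 ` D (head G e0)"
      using D_cover[OF v] by blast
    have "(\<Sum>e\<in>out_arcs G v. T (edge_proj G e) h y) = (\<Sum>e\<in>out_arcs G v. if e = e0 then h y else 0)"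
    proof (intro sum.cong refl)
      fix e' assume "e' \<in> out_arcs G v"
      then have "y \<in> g e' ` D (head G e') \<longleftrightarrow> e' = e0"
        using e0 v(2) g_inj[of e' e0] by (auto simp: subset_iff)
      then show "T (edge_proj G e') h y = (if e' = e0 then h y else 0)"
        using e \<open>e' \<in> _\<close> v(2) by auto
    qed
    also have "\<dots> = h y" using fin e0 by simp
    also have "\<dots> = T (vertex_elem G v) h y"
      using True V by (intro T_eq[symmetric] PSv) (auto simp: act_vertex_elem)
    finally show ?thesis .
  next
    case False
    then have "y \<notin> g e' ` D (head G e')" if "e' \<in> out_arcs G v" for e'
      using that g_in v(2) by fastforce
    then have "(\<Sum>e\<in>out_arcs G v. T (edge_proj G e) h y) = 0"
      using e v(2) by (intro sum.neutral) auto
    also have "\<dots> = T (vertex_elem G v) h y"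
      using False V by (intro T_eq_0[symmetric]) (auto simp: act_vertex_elem)
    finally show ?thesis .
  qed
  then show ?thesis by (simp add: rho_diff rho_sum rho_single)
qed

end

section \<open>The ideal of Leavitt relations\<close>

context wf_digraph
begin

definition leavitt_ideal :: "(('a, 'b) path_map \<Rightarrow>\<^sub>0 'k::comm_ring_1) set" where
  "leavitt_ideal = ideal_generated (graph_semigroup_algebra TYPE('k) G) (leavitt_relators TYPE('k) G)"

lemma conv_closed_PS:
  "Poly_Mapping.keys f \<subseteq> PS \<Longrightarrow> Poly_Mapping.keys f' \<subseteq> PS \<Longrightarrow>
    Poly_Mapping.keys (conv pm_comp f f') \<subseteq> PS"
  by (rule keys_conv[of PS pm_comp]) (auto intro: PS_closed)

lemma edge_proj_in_PS: "e \<in> arcs G \<Longrightarrow> edge_proj G e \<in> PS"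
  by (auto simp: edge_proj_def intro!: path_star_in_PS)

lemma vertex_elem_in_PS: "v \<in> verts G \<Longrightarrow> vertex_elem G v \<in> PS"
  by (auto simp: vertex_elem_def intro!: path_star_in_PS)

definition relator :: "'a \<Rightarrow> ('a, 'b) path_map \<Rightarrow>\<^sub>0 'k::comm_ring_1" where
  "relator v = Poly_Mapping.single (vertex_elem G v) 1
    - (\<Sum>e\<in>out_arcs G v. Poly_Mapping.single (edge_proj G e) 1)"

lemma keys_relator:
  assumes "v \<in> verts G" shows "Poly_Mapping.keys (relator v) \<subseteq> PS"
  unfolding relator_def
  by (intro order_trans[OF keys_diff] Un_least keys_sum_subset)
    (use assms in \<open>auto simp: vertex_elem_in_PS edge_proj_in_PS\<close>)

lemma leavitt_relators_eq:
  "leavitt_relators TYPE('k::comm_ring_1) G = insert (Poly_Mapping.single {} 1) {relator v | v. regular_vertex G v}"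
  by (simp add: leavitt_relators_def relator_def)

text \<open>The additive inverse of the ring record is an abstract group inverse; identifying it
  with unary minus allows ideals to be checked with the operations of the type of coefficient
  functions.\<close>

lemma algebra_idealI:
  fixes J :: "(('a, 'b) path_map \<Rightarrow>\<^sub>0 'k::comm_ring_1) set"
  assumes "\<And>f. f \<in> J \<Longrightarrow> Poly_Mapping.keys f \<subseteq> PS" "0 \<in> J"
    and "\<And>f f'. f \<in> J \<Longrightarrow> f' \<in> J \<Longrightarrow> f + f' \<in> J" "\<And>f. f \<in> J \<Longrightarrow> - f \<in> J"
    and "\<And>c f. f \<in> J \<Longrightarrow> Poly_Mapping.map ((*) c) f \<in> J"
    and "\<And>f x. f \<in> J \<Longrightarrow> Poly_Mapping.keys x \<subseteq> PS \<Longrightarrow> conv pm_comp x f \<in> J"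
    and "\<And>f x. f \<in> J \<Longrightarrow> Poly_Mapping.keys x \<subseteq> PS \<Longrightarrow> conv pm_comp f x \<in> J"
  shows "algebra_ideal J (graph_semigroup_algebra TYPE('k) G)"
proof -
  let ?A = "semigroup_algebra PS pm_comp :: ('k, ('a, 'b) path_map \<Rightarrow>\<^sub>0 'k) module"
  have cg: "comm_group (add_monoid ?A)"
  proof (rule comm_groupI)
    fix x assume x: "x \<in> carrier (add_monoid ?A)"
    show "\<exists>y\<in>carrier (add_monoid ?A). y \<otimes>\<^bsub>add_monoid ?A\<^esub> x = \<one>\<^bsub>add_monoid ?A\<^esub>"
      by (rule bexI[of _ "-x"]) (use x in auto)
  qed (auto simp: algebra_simps subset_iff dest: set_mp[OF keys_add])
  have "inv\<^bsub>add_monoid ?A\<^esub> f = - f" if "f \<in> J" for f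
    by (rule group.inv_equality[OF comm_group.axioms(2)[OF cg]]) (use assms(1)[OF that] in auto)
  then have "subgroup J (add_monoid ?A)"
    by (intro group.subgroupI[OF comm_group.axioms(2)[OF cg]]) (use assms in auto)
  then show ?thesis
    unfolding algebra_ideal_def graph_semigroup_algebra_def
    by (auto simp: assms additive_subgroup_def)
qed

lemma leavitt_ideal_subset:
  assumes "algebra_ideal J (graph_semigroup_algebra TYPE('k::comm_ring_1) G)"
    and "leavitt_relators TYPE('k) G \<subseteq> J"
  shows "leavitt_ideal \<subseteq> J"
  using assms by (auto simp: leavitt_ideal_def ideal_generated_def)

lemma relators_subset_leavitt_ideal:
  "leavitt_relators TYPE('k::comm_ring_1) G \<subseteq> leavitt_ideal"
  by (auto simp: leavitt_ideal_def ideal_generated_def)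

lemma algebra_ideal_leavitt_ideal:
  "algebra_ideal (leavitt_ideal :: (('a, 'b) path_map \<Rightarrow>\<^sub>0 'k::comm_ring_1) set)
    (graph_semigroup_algebra TYPE('k) G)"
proof (rule algebra_idealI)
  let ?A = "graph_semigroup_algebra TYPE('k) G"
  let ?I = "leavitt_ideal :: (('a, 'b) path_map \<Rightarrow>\<^sub>0 'k) set"
  \<comment> \<open>The whole algebra is an ideal containing the relators. Hence the intersection
    defining the generated ideal is not taken over an empty family, and its members are supported on
    the semigroup.\<close>
  have top: "?I \<subseteq> {f. Poly_Mapping.keys f \<subseteq> PS}"
  proof (rule leavitt_ideal_subset)
    show "algebra_ideal {f. Poly_Mapping.keys f \<subseteq> PS} ?A"
      by (rule algebra_idealI) (auto simp: conv_closed_PS[THEN subsetD] dest!: set_mp[OF keys_add] set_mp[OF keys_map_times])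
    show "leavitt_relators TYPE('k) G \<subseteq> {f. Poly_Mapping.keys f \<subseteq> PS}"
      using keys_relator by (auto simp: leavitt_relators_eq regular_vertex_def graph_inverse_semigroup_def)
  qed
  then show "Poly_Mapping.keys f \<subseteq> PS" if "f \<in> ?I" for f using that by blast
  have mem: "f \<in> ?I \<longleftrightarrow> (\<forall>I. algebra_ideal I ?A \<longrightarrow> leavitt_relators TYPE('k) G \<subseteq> I \<longrightarrow> f \<in> I)" for f
    by (auto simp: leavitt_ideal_def ideal_generated_def)
  have loc: "semigroup_algebra_ideal PS pm_comp I"  if "algebra_ideal I ?A" for I :: "(('a, 'b) path_map \<Rightarrow>\<^sub>0 'k) set"
    by standard (use that in \<open>auto simp: PS_closed graph_semigroup_algebra_def\<close>)
  show "0 \<in> ?I" unfolding mem using semigroup_algebra_ideal.I_zero[OF loc] by blast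
  show "f + f' \<in> ?I" if "f \<in> ?I" "f' \<in> ?I" for f f' using that unfolding mem using semigroup_algebra_ideal.I_add[OF loc] by blast
  show "- f \<in> ?I" if "f \<in> ?I" for f using that unfolding mem using semigroup_algebra_ideal.I_uminus[OF loc] by blast
  show "Poly_Mapping.map ((*) c) f \<in> ?I" if "f \<in> ?I" for c f using that unfolding mem using semigroup_algebra_ideal.I_scale[OF loc] by blast
  show "conv pm_comp x f \<in> ?I" "conv pm_comp f x \<in> ?I" if "f \<in> ?I" "Poly_Mapping.keys x \<subseteq> PS" for x f
    using that unfolding mem using semigroup_algebra_ideal.I_mult[OF loc] by blast+
qed

sublocale leavitt: semigroup_algebra_ideal "graph_inverse_semigroup G" pm_comp leavitt_ideal
  by standard (use algebra_ideal_leavitt_ideal in \<open>auto simp: PS_closed graph_semigroup_algebra_def\<close>)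

lemma leavitt_path_algebra_eq:
  "leavitt_path_algebra TYPE('k::comm_ring_1) G = semigroup_algebra PS pm_comp Quot leavitt_ideal"
  by (simp add: leavitt_path_algebra_def leavitt_ideal_def graph_semigroup_algebra_def)

section \<open>Elements acting as zero for all large finite sets of arcs\<close>

lemma eventually_arcs_balanced_keys:
  assumes "Poly_Mapping.keys f \<subseteq> PS"
  shows "\<forall>\<^sub>F F in finite_subsets_at_top (arcs G). Poly_Mapping.keys f \<subseteq> {s \<in> PS. arcs_balanced F s}"
proof -
  have "\<forall>\<^sub>F F in finite_subsets_at_top (arcs G). \<forall>s\<in>Poly_Mapping.keys f. arcs_balanced F s"
    using assms by (intro eventually_ball_finite ballI eventually_arcs_balanced) auto
  then show ?thesis by eventually_elim (use assms in auto)
qed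

text \<open>All systems over \<open>F\<close> on points of one type are considered at once. The type
  is passed as an argument because it occurs only in bound variables of the body.\<close>

definition vanishing :: "'y itself \<Rightarrow> 'b set \<Rightarrow> (('a, 'b) path_map \<Rightarrow>\<^sub>0 'k::comm_ring_1) \<Rightarrow> bool" where
  "vanishing _ F f \<longleftrightarrow> (\<forall>D (g::'b \<Rightarrow> 'y \<Rightarrow> 'y). branching_system G F D g \<longrightarrow>
      (\<forall>h y. branching_system.rho G F D g f h y = 0))"

text \<open>The elements with this property form an ideal that contains the relators. Multiplication
  by \<open>x\<close> requires \<open>F\<close> to balance the keys of both factors, and the relator
  of \<open>v\<close> requires \<open>F\<close> to contain the arcs at \<open>v\<close>; the filter
  merges these demands.\<close>

lemma leavitt_ideal_vanishing:
  fixes f :: "('a, 'b) path_map \<Rightarrow>\<^sub>0 'k::comm_ring_1"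
  assumes "f \<in> leavitt_ideal"
  shows "\<forall>\<^sub>F F in finite_subsets_at_top (arcs G). vanishing TYPE('y) F f"
proof -
  define J :: "(('a, 'b) path_map \<Rightarrow>\<^sub>0 'k) set" where
    "J = {f. Poly_Mapping.keys f \<subseteq> PS \<and> (\<forall>\<^sub>F F in finite_subsets_at_top (arcs G). vanishing TYPE('y) F f)}"
  note bs = branching_system.rho_add branching_system.rho_zero branching_system.rho_uminus branching_system.rho_scale
  have "leavitt_ideal \<subseteq> J"
  proof (rule leavitt_ideal_subset)
    show "algebra_ideal J (graph_semigroup_algebra TYPE('k) G)"
    proof (rule algebra_idealI)
      fix f f' and c :: 'k
      assume "f \<in> J" "f' \<in> J"
      then have k: "Poly_Mapping.keys f \<subseteq> PS" "Poly_Mapping.keys f' \<subseteq> PS"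
        and v: "\<forall>\<^sub>F F in finite_subsets_at_top (arcs G). vanishing TYPE('y) F f"
          "\<forall>\<^sub>F F in finite_subsets_at_top (arcs G). vanishing TYPE('y) F f'"
        by (auto simp: J_def)
      have "\<forall>\<^sub>F F in finite_subsets_at_top (arcs G). vanishing TYPE('y) F (f + f')"
        using v by eventually_elim (auto simp: vanishing_def bs)
      then show "f + f' \<in> J" using k keys_add[of f f'] by (auto simp: J_def)
      have "\<forall>\<^sub>F F in finite_subsets_at_top (arcs G). vanishing TYPE('y) F (- f)"
        using v(1) by eventually_elim (auto simp: vanishing_def bs)
      then show "- f \<in> J" using k by (auto simp: J_def)
      have "\<forall>\<^sub>F F in finite_subsets_at_top (arcs G). vanishing TYPE('y) F (Poly_Mapping.map ((*) c) f)"
        using v(1) by eventually_elim (auto simp: vanishing_def bs)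
      then show "Poly_Mapping.map ((*) c) f \<in> J" using k keys_map_times[of c f] by (auto simp: J_def)
    next
      fix f x :: "('a, 'b) path_map \<Rightarrow>\<^sub>0 'k"
      assume "f \<in> J" and x: "Poly_Mapping.keys x \<subseteq> PS"
      then have k: "Poly_Mapping.keys f \<subseteq> PS"
        and v: "\<forall>\<^sub>F F in finite_subsets_at_top (arcs G). vanishing TYPE('y) F f"
        by (auto simp: J_def)
      have "\<forall>\<^sub>F F in finite_subsets_at_top (arcs G). vanishing TYPE('y) F (conv pm_comp x f)
          \<and> vanishing TYPE('y) F (conv pm_comp f x)"
        using v eventually_arcs_balanced_keys[OF k] eventually_arcs_balanced_keys[OF x]
      proof eventually_elim
        case (elim F)
        have "branching_system.rho G F D g (conv pm_comp x f) h y = 0"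
          "branching_system.rho G F D g (conv pm_comp f x) h y = 0"
          if "branching_system G F D g" for D and g :: "'b \<Rightarrow> 'y \<Rightarrow> 'y" and h y
        proof -
          interpret branching_system G F D g by fact
          have "rho f h = (\<lambda>_. 0)" for h using elim(1) that by (auto simp: vanishing_def)
          then show "rho (conv pm_comp x f) h y = 0" "rho (conv pm_comp f x) h y = 0"
            using elim by (simp_all add: rho_conv)
        qed
        then show ?case by (auto simp: vanishing_def)
      qed
      then show "conv pm_comp x f \<in> J" "conv pm_comp f x \<in> J"
        using k x by (auto simp: J_def conv_closed_PS[THEN subsetD] eventually_conj_iff)
    qed (auto simp: J_def vanishing_def bs)
    show "leavitt_relators TYPE('k) G \<subseteq> J"
    proof (unfold leavitt_relators_eq, safe)
      have "branching_system.rho G F D g (Poly_Mapping.single {} (1::'k)) h y = 0"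
        if "branching_system G F D g" for F D and g :: "'b \<Rightarrow> 'y \<Rightarrow> 'y" and h y
        using that by (simp add: branching_system.rho_single branching_system.T_eq_0 branching_system.act_empty)
      then show "Poly_Mapping.single {} 1 \<in> J"
        by (simp add: J_def vanishing_def graph_inverse_semigroup_def)
    next
      fix v assume v: "regular_vertex G v"
      then have "\<forall>\<^sub>F F in finite_subsets_at_top (arcs G). out_arcs G v \<subseteq> F"
        unfolding eventually_finite_subsets_at_top
        by (intro exI[of _ "out_arcs G v"]) (auto simp: regular_vertex_def)
      then have "\<forall>\<^sub>F F in finite_subsets_at_top (arcs G). vanishing TYPE('y) F (relator v :: ('a, 'b) path_map \<Rightarrow>\<^sub>0 'k)"
        by eventually_elim (use v in \<open>auto simp: vanishing_def relator_def branching_system.rho_relator\<close>)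
      then show "relator v \<in> J"
        using v keys_relator[of v] by (auto simp: J_def regular_vertex_def)
    qed
  qed
  then show ?thesis using assms by (auto simp: J_def)
qed

end

section \<open>Exits of cycles\<close>

context wf_digraph
begin

text \<open>Simple cycles are traded for arbitrary closed walks through a given arc. A return path
  shortens to a simple one without touching the arc \<open>e\<close> in front of it; conversely, a
  cycle is rotated so as to start with \<open>e\<close>.\<close>

lemma no_exit_iff:
  "no_exit G \<longleftrightarrow> (\<forall>e p f. e \<in> arcs G \<longrightarrow> (head G e, p) \<in> paths G \<longrightarrow> path_end G (head G e, p) = tail G e \<longrightarrow>
    f \<in> arcs G \<longrightarrow> tail G f = tail G e \<longrightarrow> f = e)"
proof (intro iffI allI impI)
  fix e p f
  assume ne: "no_exit G" and e: "e \<in> arcs G" "(head G e, p) \<in> paths G" "path_end G (head G e, p) = tail G e"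
    and f: "f \<in> arcs G" "tail G f = tail G e"
  have "apath (head G e) (awalk_to_apath p) (tail G e)"
    using e by (intro apath_awalk_to_apath) (simp add: paths_iff)
  then have "cycle (e # awalk_to_apath p)"
    using e by (auto simp: cycle_def apath_def awalk_Cons_iff)
  then have "out_degree G (tail G e) = 1"
    using ne by (auto simp: no_exit_def)
  then obtain x where "out_arcs G (tail G e) = {x}"
    by (auto simp: out_degree_def card_1_singleton_iff)
  moreover have "e \<in> out_arcs G (tail G e)" "f \<in> out_arcs G (tail G e)" using e f by auto
  ultimately show "f = e" by (metis singletonD)
next
  assume *: "\<forall>e p f. e \<in> arcs G \<longrightarrow> (head G e, p) \<in> paths G \<longrightarrow> path_end G (head G e, p) = tail G e \<longrightarrow>
    f \<in> arcs G \<longrightarrow> tail G f = tail G e \<longrightarrow> f = e"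
  have "out_degree G (tail G e) = 1" if c: "cycle c" and "e \<in> set c" for c e
  proof -
    obtain u where u: "awalk u c u" using c by (auto simp: cycle_def)
    obtain xs ys where "c = xs @ e # ys" using \<open>e \<in> set c\<close> by (meson split_list)
    with u have "awalk (head G e) ys u" "awalk u xs (tail G e)" "e \<in> arcs G"
      by (auto simp: awalk_Cons_iff)
    then have "awalk (head G e) (ys @ xs) (tail G e)" by (metis awalk_appendI)
    then have "(head G e, ys @ xs) \<in> paths G" "path_end G (head G e, ys @ xs) = tail G e"
      by (auto simp: paths_def path_end_def)
    then have "out_arcs G (tail G e) = {e}"
      using *[rule_format, OF \<open>e \<in> arcs G\<close>] \<open>e \<in> arcs G\<close> by auto
    then show ?thesis by (simp add: out_degree_def)
  qed
  then show "no_exit G" by (auto simp: no_exit_def)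
qed

text \<open>Over each vertex lies a copy of \<open>\<nat>\<close>. The \<open>m\<close> arcs of
  \<open>F\<close> leaving it are numbered from \<open>0\<close>, and arc number \<open>i\<close>
  acts as \<open>k \<mapsto> m k + i\<close>: injectivity and covering are division with remainder
  by \<open>m\<close>.\<close>

lemma branching_system_nat:
  assumes F: "finite F" "F \<subseteq> arcs G"
  obtains g :: "'b \<Rightarrow> 'a \<times> nat \<Rightarrow> 'a \<times> nat"
  where "branching_system G F (\<lambda>v. {v} \<times> UNIV) g"
proof -
  define m where "m v = card (out_arcs G v \<inter> F)" for v
  have "\<exists>i. bij_betw i (out_arcs G v \<inter> F) {0..<m v}" for v
    unfolding m_def using F by (intro ex_bij_betw_finite_nat) auto
  then obtain i where i: "\<And>v. bij_betw (i v) (out_arcs G v \<inter> F) {0..<m v}" by metis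
  define g :: "'b \<Rightarrow> 'a \<times> nat \<Rightarrow> 'a \<times> nat"
    where "g e y = (tail G e, m (tail G e) * snd y + i (tail G e) e)" for e y
  have i_less: "i (tail G e) e < m (tail G e)" if "e \<in> F" for e
    using bij_betwE[OF i, of "tail G e"] that F by auto
  have "branching_system G F (\<lambda>v. {v} \<times> UNIV) g"
  proof unfold_locales
    fix e e' and y y' :: "'a \<times> nat"
    assume e: "e \<in> F" "e' \<in> F" and y: "y \<in> {head G e} \<times> UNIV" "y' \<in> {head G e'} \<times> UNIV"
      and eq: "g e y = g e' y'"
    define v where "v = tail G e"
    have t: "tail G e' = v" "tail G e = v" and
      eq': "m v * snd y + i v e = m v * snd y' + i v e'" using eq by (auto simp: g_def v_def)
    have less: "i v e < m v" "i v e' < m v" using i_less[OF e(1)] i_less[OF e(2)] t by auto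
    have "i v e = (m v * snd y + i v e) mod m v" using less by simp
    also have "\<dots> = i v e'" using less by (subst eq') simp
    finally have "i v e = i v e'" .
    then have "e = e'"
      using e t F by (intro inj_onD[OF bij_betw_imp_inj_on[OF i[of v]]]) auto
    moreover have "snd y = snd y'" using eq' \<open>i v e = i v e'\<close> less by auto
    ultimately show "e = e' \<and> y = y'" using y by (auto simp: prod_eq_iff)
  next
    fix v and y :: "'a \<times> nat"
    assume v: "regular_vertex G v" "out_arcs G v \<subseteq> F" and y: "y \<in> {v} \<times> UNIV"
    have "0 < m v"
      using v F by (auto simp: m_def regular_vertex_def card_gt_0_iff)
    then have "snd y mod m v \<in> {0..<m v}" by simp
    then have "snd y mod m v \<in> i v ` (out_arcs G v \<inter> F)"
      using i[of v] by (simp add: bij_betw_def)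
    then obtain e where e: "e \<in> out_arcs G v" "snd y mod m v = i v e" by auto
    then have "tail G e = v" by simp
    then have "y = g e (head G e, snd y div m v)"
      using y e(2)[symmetric] by (simp only: g_def snd_conv mult_div_mod_eq) (auto simp: prod_eq_iff)
    then show "\<exists>e\<in>out_arcs G v. \<exists>z\<in>{head G e} \<times> UNIV. y = g e z" using e(1) by blast
  qed (use F in \<open>auto simp: g_def\<close>)
  then show thesis by (rule that)
qed

text \<open>The closed path \<open>c = ep\<close> starts with the arc whose source also emits
  \<open>f\<close>. The elements \<open>U = c\<^sup>*\<close> and \<open>V = c\<close> lie in the
  corner of the vertex \<open>v\<close>, with \<open>UV = v\<close> and
  \<open>VU = cc\<^sup>*\<close>, so Dedekind finiteness would put \<open>cc\<^sup>* - v\<close>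
  into the ideal.\<close>

lemma exit_not_dedekind_finite:
  assumes e: "e \<in> arcs G" and p: "(head G e, p) \<in> paths G" "path_end G (head G e, p) = tail G e"
    and f: "f \<in> arcs G" "tail G f = tail G e" "f \<noteq> e"
  shows "\<not> dedekind_finite (leavitt_path_algebra TYPE('k::comm_ring_1) G)"
proof
  define v where "v = tail G e"
  define c where "c = (v, e # p)"
  define E U V :: "('a, 'b) path_map \<Rightarrow>\<^sub>0 'k" where
    "E = Poly_Mapping.single (path_star G (v, []) (v, [])) 1" and
    "U = Poly_Mapping.single (path_star G (v, []) c) 1" and
    "V = Poly_Mapping.single (path_star G c (v, [])) 1"
  have vs: "v \<in> verts G" "c \<in> paths G" "(v, e # p) \<in> paths G" "path_end G c = v"
    using e p by (auto simp: v_def c_def)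
  then have PS: "path_star G (v, []) (v, []) \<in> PS" "path_star G (v, []) c \<in> PS"
    "path_star G c (v, []) \<in> PS" "path_star G c c \<in> PS"
    by (auto intro!: path_star_in_PS)
  have comp: "pm_comp (path_star G a (v', fs)) (path_star G (v', fs) (w, gs)) = path_star G a (w, gs)"
    if "(v', fs) \<in> paths G" "path_end G (v', fs) = path_end G (w, gs)" for a v' fs w gs
    using path_star_comp[of v' fs "[]" w gs "fst a" "snd a"] that by simp
  have comp_Nil: "pm_comp (path_star G (u, es) (v', [])) (path_star G (v', ys) (w, gs)) = path_star G (u, es @ ys) (w, gs)"
    if "(v', ys) \<in> paths G" "path_end G (v', ys) = path_end G (w, gs)" for u es v' ys w gs
    using path_star_comp[of v' "[]" ys w gs u es] that by simp
  have comp_Nil': "pm_comp (path_star G (u, es) (v', ys)) (path_star G (v', []) (w, gs)) = path_star G (u, es) (w, gs @ ys)"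
    if "(v', ys) \<in> paths G" "v' = path_end G (w, gs)" for u es v' ys w gs
    using path_star_comp'[of v' "[]" ys w gs u es] that by simp
  have mults: "conv pm_comp E E = E" "conv pm_comp (conv pm_comp E U) E = U"
    "conv pm_comp (conv pm_comp E V) E = V" "conv pm_comp U V = E"
    "conv pm_comp V U = Poly_Mapping.single (path_star G c c) 1"
    using vs e p(2) by (simp_all add: E_def U_def V_def c_def comp comp_Nil comp_Nil' v_def)
  assume "dedekind_finite (leavitt_path_algebra TYPE('k) G)"
  then have "leavitt.\<pi> (conv pm_comp V U) = leavitt.\<pi> E"
    using leavitt.dedekind_finite_iff[THEN iffD1, rule_format, of E U V] PS
    by (simp add: leavitt_path_algebra_eq mults) (simp add: E_def U_def V_def)
  then have "Poly_Mapping.single (path_star G c c) 1 - E \<in> leavitt_ideal"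
    using PS by (subst (asm) leavitt.\<pi>_eq_iff) (simp_all add: mults E_def)
  then have "\<forall>\<^sub>F F in finite_subsets_at_top (arcs G).
      vanishing TYPE('a \<times> nat) F (Poly_Mapping.single (path_star G c c) 1 - E)"
    by (rule leavitt_ideal_vanishing)
  moreover have "\<forall>\<^sub>F F in finite_subsets_at_top (arcs G). finite F \<and> insert f (insert e (set p)) \<subseteq> F \<and> F \<subseteq> arcs G"
    unfolding eventually_finite_subsets_at_top
    using e f path_arcs[OF p(1)] by (intro exI[of _ "insert f (insert e (set p))"]) auto
  ultimately have "\<forall>\<^sub>F F in finite_subsets_at_top (arcs G).
      vanishing TYPE('a \<times> nat) F (Poly_Mapping.single (path_star G c c) 1 - E)
      \<and> finite F \<and> insert f (insert e (set p)) \<subseteq> F \<and> F \<subseteq> arcs G"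
    by eventually_elim auto
  from eventually_happens[OF this] obtain F where
    van: "vanishing TYPE('a \<times> nat) F (Poly_Mapping.single (path_star G c c) 1 - E)"
    and F: "finite F" "insert f (insert e (set p)) \<subseteq> F" "F \<subseteq> arcs G"
    by (auto simp: finite_subsets_at_top_neq_bot)
  obtain g :: "'b \<Rightarrow> 'a \<times> nat \<Rightarrow> 'a \<times> nat" where g: "branching_system G F (\<lambda>v. {v} \<times> UNIV) g"
    using branching_system_nat[OF F(1,3)] .
  interpret branching_system G F "\<lambda>v. {v} \<times> UNIV" g by (rule g)
  define y where "y = g f (head G f, 0)"
  have "y \<in> {v} \<times> UNIV" using g_in[of f "(head G f, 0)"] F f by (simp add: y_def v_def)
  then have "(y, y) \<in> act (path_star G (v, []) (v, []))"
    using act_vertex_elem[OF vs(1)] by (auto simp: vertex_elem_def)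
  then have 1: "T (path_star G (v, []) (v, [])) (\<lambda>_. 1::'k) y = 1"
    using PS by (simp add: T_eq)
  have "(x, y) \<notin> act (path_star G c c)" for x
  proof
    assume "(x, y) \<in> act (path_star G c c)"
    then obtain z where z: "z \<in> {v} \<times> UNIV" "y = g e (foldr g p z)"
      using vs F by (auto simp: act_path_star c_def)
    moreover have "foldr g p z \<in> {head G e} \<times> UNIV"
      by (rule foldr_in[OF p(1)]) (use z p F in \<open>auto simp: v_def\<close>)
    ultimately have "f = e"
      using g_inj[of f e "(head G f, 0)" "foldr g p z"] F by (auto simp: y_def)
    then show False using f by simp
  qed
  then have 0: "T (path_star G c c) (\<lambda>_. 1::'k) y = 0" by (rule T_eq_0)
  \<comment> \<open>The constant function \<open>1\<close> separates the two operators: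
    \<open>v\<close> keeps its value at \<open>y\<close>, while \<open>cc\<^sup>*\<close> gives
    \<open>0\<close> because \<open>y\<close> is not in its image. The difference is
    \<open>-1\<close>, which is nonzero in \<open>K\<close>.\<close>
  have "rho (Poly_Mapping.single (path_star G c c) 1 - E) (\<lambda>_. 1::'k) y = 0"
    using van g unfolding vanishing_def by blast
  then show False using 0 1 by (simp add: rho_diff rho_single E_def)
qed

end

section \<open>Faithful branching systems\<close>

text \<open>Sandwiching the relator of \<open>w\<close> between \<open>cp\<close> and
  \<open>q\<^sup>*\<close> shows that modulo the ideal \<open>pq\<^sup>*\<close> may be replaced by
  the sum of all \<open>pe(qe)\<^sup>*\<close>.\<close>

lemma (in wf_digraph) expand_path_star:
  assumes es: "(u, es) \<in> paths G" "path_end G (u, es) = w" and fs: "(v, fs) \<in> paths G" "path_end G (v, fs) = w"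
  shows "conv pm_comp (conv pm_comp (Poly_Mapping.single (path_star G (u, es) (w, [])) c) (relator w))
      (Poly_Mapping.single (path_star G (w, []) (v, fs)) 1)
    = Poly_Mapping.single (path_star G (u, es) (v, fs)) c
      - (\<Sum>e\<in>out_arcs G w. Poly_Mapping.single (path_star G (u, es @ [e]) (v, fs @ [e])) c)"
proof -
  have w: "w \<in> verts G" using path_end_in_verts[OF es(1)] es(2) by simp
  have "pm_comp (path_star G (u, es) (w, [])) (edge_proj G e) = path_star G (u, es @ [e]) (w, [e])"
    if "e \<in> out_arcs G w" for e
    using that path_star_comp[of w "[]" "[e]" w "[e]" u es] by (auto simp: edge_proj_def)
  moreover have "pm_comp (path_star G (u, es @ [e]) (w, [e])) (path_star G (w, []) (v, fs))
      = path_star G (u, es @ [e]) (v, fs @ [e])" if "e \<in> out_arcs G w" for e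
    using that path_star_comp'[of w "[]" "[e]" v fs u "es @ [e]"] fs by auto
  moreover have "pm_comp (path_star G (u, es) (w, [])) (vertex_elem G w) = path_star G (u, es) (w, [])"
    using path_star_comp[of w "[]" "[]" w "[]" u es] w by (simp add: vertex_elem_def)
  moreover have "pm_comp (path_star G (u, es) (w, [])) (path_star G (w, []) (v, fs)) = path_star G (u, es) (v, fs)"
    using path_star_comp[of w "[]" "[]" v fs u es] w fs by simp
  ultimately show ?thesis
    by (simp add: relator_def conv_diff_left conv_diff_right conv_sum_left conv_sum_right)
qed

text \<open>
  The last assumption excludes short closed paths fixing a point; it is what separates the powers of
  a cycle.
\<close>

locale faithful_branching_system = branching_system G F D g
  for G :: "('a, 'b) pre_digraph" and F and D :: "'a \<Rightarrow> 'y set" and g +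
  fixes V :: "'a set" and L :: nat
  assumes head_V: "e \<in> F \<Longrightarrow> head G e \<in> V"
    and D_nonempty: "v \<in> V \<Longrightarrow> D v \<noteq> {}"
    and D_free: "v \<in> V \<Longrightarrow> \<not> (regular_vertex G v \<and> out_arcs G v \<subseteq> F) \<Longrightarrow>
      \<exists>z\<in>D v. \<forall>e\<in>F. \<forall>z'\<in>D (head G e). z \<noteq> g e z'"
    and no_fixed: "z \<in> D v \<Longrightarrow> foldr g xs z = z \<Longrightarrow> length xs \<le> 2 * L \<Longrightarrow> xs = []"
begin

abbreviation "saturated v \<equiv> regular_vertex G v \<and> out_arcs G v \<subseteq> F"

text \<open>The length bounds are asymmetric because reduction appends the same arc to both paths
  until \<open>fs\<close> has length \<open>L\<close>. Their difference is invariant, and in the end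
  \<open>es\<close> has length at most \<open>2 * L\<close>.\<close>

inductive pair :: "('a, 'b) path \<Rightarrow> ('a, 'b) path \<Rightarrow> bool" where
  pairI: "(u, es) \<in> paths G \<Longrightarrow> (v, fs) \<in> paths G \<Longrightarrow> path_end G (u, es) = path_end G (v, fs) \<Longrightarrow>
    path_end G (v, fs) \<in> V \<Longrightarrow> set es \<subseteq> F \<Longrightarrow> set fs \<subseteq> F \<Longrightarrow>
    length es \<le> length fs + L \<Longrightarrow> length fs \<le> L \<Longrightarrow> pair (u, es) (v, fs)"

text \<open>Normal forms: either \<open>q\<close> has the full length \<open>L\<close>, or no
  Cuntz--Krieger relation within \<open>F\<close> is available at its end to lengthen it.\<close>

definition reduced :: "('a, 'b) path_map set" where
  "reduced = {path_star G p q | p q. pair p q \<and> (length (snd q) = L \<or> \<not> saturated (path_end G q))}"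

text \<open>Both conditions are tracked together: an element of the ideal is known to act as zero
  for large \<open>F\<close> only, whereas \<open>F\<close> is fixed here.\<close>

definition equiv0 :: "(('a, 'b) path_map \<Rightarrow>\<^sub>0 'k::comm_ring_1) \<Rightarrow> bool" where
  "equiv0 f \<longleftrightarrow> f \<in> leavitt_ideal \<and> (\<forall>h y. rho f h y = 0)"

definition reducible :: "(('a, 'b) path_map \<Rightarrow>\<^sub>0 'k::comm_ring_1) \<Rightarrow> bool" where
  "reducible f \<longleftrightarrow> (\<exists>f'. equiv0 (f - f') \<and> Poly_Mapping.keys f' \<subseteq> reduced)"

section \<open>Reduction to normal form\<close>

lemma equiv0_add: "equiv0 f \<Longrightarrow> equiv0 f' \<Longrightarrow> equiv0 (f + f')"
  by (simp add: equiv0_def leavitt.I_add rho_add)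

lemma reducible_add:
  assumes "reducible f" "reducible f'" shows "reducible (f + f')"
proof -
  obtain r r' where r: "equiv0 (f - r)" "Poly_Mapping.keys r \<subseteq> reduced"
    "equiv0 (f' - r')" "Poly_Mapping.keys r' \<subseteq> reduced"
    using assms by (auto simp: reducible_def)
  have "equiv0 (f + f' - (r + r'))"
    using equiv0_add[OF r(1,3)] by (simp add: algebra_simps)
  then show ?thesis
    unfolding reducible_def using keys_add[of r r'] r(2,4) by blast
qed

lemma reducible_zero: "reducible 0"
  unfolding reducible_def by (rule exI[of _ 0]) (simp add: equiv0_def leavitt.I_zero)

lemma reducible_sum: "(\<And>i. i \<in> A \<Longrightarrow> reducible (f i)) \<Longrightarrow> reducible (\<Sum>i\<in>A. f i)"
  by (induction A rule: infinite_finite_induct) (simp_all add: reducible_zero reducible_add)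

lemma reducible_trans:
  assumes "equiv0 (f - f')" "reducible f'" shows "reducible f"
proof -
  obtain r where r: "equiv0 (f' - r)" "Poly_Mapping.keys r \<subseteq> reduced"
    using assms(2) by (auto simp: reducible_def)
  then have "equiv0 (f - r)" using equiv0_add[OF assms(1) r(1)] by simp
  then show ?thesis unfolding reducible_def using r(2) by blast
qed

text \<open>The difference is the sandwiched relator. Its factors are balanced over
  \<open>F\<close>, so its operator is a composition that contains the operator of the relator,
  which is zero because \<open>w\<close> is saturated.\<close>

lemma equiv0_expand:
  fixes c :: "'k::comm_ring_1"
  assumes es: "(u, es) \<in> paths G" "path_end G (u, es) = w" "set es \<subseteq> F"
    and fs: "(v, fs) \<in> paths G" "path_end G (v, fs) = w" "set fs \<subseteq> F"
    and w: "saturated w"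
  shows "equiv0 (Poly_Mapping.single (path_star G (u, es) (v, fs)) c
      - (\<Sum>e\<in>out_arcs G w. Poly_Mapping.single (path_star G (u, es @ [e]) (v, fs @ [e])) c))"
proof -
  have V: "w \<in> verts G" using w by (simp add: regular_vertex_def)
  let ?R = "relator w :: ('a, 'b) path_map \<Rightarrow>\<^sub>0 'k"
  let ?a = "Poly_Mapping.single (path_star G (u, es) (w, [])) c"
  let ?b = "Poly_Mapping.single (path_star G (w, []) (v, fs)) (1 :: 'k)"
  have k1: "Poly_Mapping.keys ?a \<subseteq> {s \<in> PS. arcs_balanced F s}"
    using es V by (auto intro!: path_star_in_PS arcs_balanced_path_star)
  have k2: "Poly_Mapping.keys ?R \<subseteq> {s \<in> PS. arcs_balanced F s}"
    unfolding relator_def using V w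
    by (intro order_trans[OF keys_diff] Un_least keys_sum_subset)
      (auto simp: vertex_elem_in_PS edge_proj_in_PS vertex_elem_def[of G] edge_proj_def[of G]
        intro!: arcs_balanced_path_star path_star_in_PS)
  have k3: "Poly_Mapping.keys ?b \<subseteq> {s \<in> PS. arcs_balanced F s}"
    using fs V by (auto intro!: path_star_in_PS arcs_balanced_path_star)
  have R0: "rho ?R h = (\<lambda>_. 0)" for h
    using rho_relator[of w] w by (auto simp: relator_def)
  have "rho (conv pm_comp (conv pm_comp ?a ?R) ?b) h y = 0" for h y
  proof -
    have "Poly_Mapping.keys (conv pm_comp ?a ?R) \<subseteq> {s \<in> PS. arcs_balanced F s}"
    proof -
      have "pm_comp s t \<in> {s \<in> PS. arcs_balanced F s}"
        if "s \<in> {s \<in> PS. arcs_balanced F s}" "t \<in> {s \<in> PS. arcs_balanced F s}" for s t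
        using that PS_closed by (fastforce simp: arcs_balanced_def pm_comp_def)
      then show ?thesis by (rule keys_conv) (use k1 k2 in auto)
    qed
    then show ?thesis by (simp only: rho_conv k1 k2 k3 R0 rho_zero_right)
  qed
  moreover have "conv pm_comp (conv pm_comp ?a ?R) ?b \<in> leavitt_ideal"
  proof -
    have "?R \<in> leavitt_ideal"
      using w relators_subset_leavitt_ideal unfolding leavitt_relators_eq by blast
    moreover have "Poly_Mapping.keys ?a \<subseteq> PS" "Poly_Mapping.keys ?b \<subseteq> PS" using k1 k3 by blast+
    ultimately show ?thesis by (intro leavitt.I_mult)
  qed
  ultimately show ?thesis
    unfolding expand_path_star[OF es(1,2) fs(1,2)] equiv0_def by blast
qed

text \<open>Each expansion lengthens \<open>q\<close> by one arc. It is possible below length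
  \<open>L\<close> at a saturated vertex, whose arcs all lie in \<open>F\<close> and hence lead back
  into \<open>V\<close>.\<close>

lemma reducible_single:
  assumes "pair p q" shows "reducible (Poly_Mapping.single (path_star G p q) c)"
  using assms
proof (induction "L - length (snd q)" arbitrary: p q rule: less_induct)
  case less
  from less.prems show ?case
  proof (cases rule: pair.cases)
    case (pairI u es v fs)
    define w where "w = path_end G (v, fs)"
    show ?thesis
    proof (cases "length fs = L \<or> \<not> saturated w")
      case True
      then have "path_star G p q \<in> reduced"
        unfolding reduced_def pairI(1,2) using less.prems[unfolded pairI(1,2)]
        by (intro CollectI exI[of _ "(u, es)"] exI[of _ "(v, fs)"]) (simp add: w_def)
      then show ?thesis
        unfolding reducible_def
        by (intro exI[of _ "Poly_Mapping.single (path_star G p q) c"]) (simp add: equiv0_def leavitt.I_zero)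
    next
      case False
      have "reducible (\<Sum>e\<in>out_arcs G w. Poly_Mapping.single (path_star G (u, es @ [e]) (v, fs @ [e])) c)"
      proof (intro reducible_sum less.hyps)
        fix e assume "e \<in> out_arcs G w"
        then have e: "e \<in> arcs G" "tail G e = w" "e \<in> F" using False by auto
        show "L - length (snd (v, fs @ [e])) < L - length (snd q)"
          using False pairI by auto
        show "pair (u, es @ [e]) (v, fs @ [e])"
          using pairI e False head_V[OF e(3)]
          by (intro pair.pairI) (auto simp: paths_append_iff path_end_append w_def)
      qed
      moreover have "equiv0 (Poly_Mapping.single (path_star G p q) c
          - (\<Sum>e\<in>out_arcs G w. Poly_Mapping.single (path_star G (u, es @ [e]) (v, fs @ [e])) c))"
        unfolding pairI(1,2) using pairI False by (intro equiv0_expand) (auto simp: w_def)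
      ultimately show ?thesis by (rule reducible_trans[rotated])
    qed
  qed
qed

lemma reducible_of_keys:
  assumes "Poly_Mapping.keys f \<subseteq> insert {} {path_star G p q | p q. pair p q}"
  shows "reducible f"
proof -
  have "reducible (Poly_Mapping.single s (Poly_Mapping.lookup f s))" if "s \<in> Poly_Mapping.keys f" for s
  proof (cases "s = {}")
    case True
    let ?c = "Poly_Mapping.lookup f s"
    have "Poly_Mapping.map ((*) ?c) (Poly_Mapping.single {} 1) \<in> leavitt_ideal"
      using relators_subset_leavitt_ideal by (intro leavitt.I_scale) (auto simp: leavitt_relators_eq)
    then have "equiv0 (Poly_Mapping.single s ?c)"
      by (simp add: True equiv0_def rho_single T_eq_0)
    then show ?thesis using reducible_trans[OF _ reducible_zero] by simp
  next
    case False
    then show ?thesis using assms that reducible_single by blast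
  qed
  then have "reducible (\<Sum>s\<in>Poly_Mapping.keys f. Poly_Mapping.single s (Poly_Mapping.lookup f s))"
    by (rule reducible_sum)
  then show ?thesis by (simp add: sum_single_lookup)
qed

text \<open>
  A key \<open>p\<^sub>0q\<^sub>0\<^sup>*\<close> with \<open>q\<^sub>0\<close> of minimal length is the only one that carries
  \<open>q\<^sub>0z\<close> to \<open>p\<^sub>0z\<close> for a suitable point \<open>z\<close>, so its coefficient can be read off.
\<close>

lemma reduced_rho_eq_0:
  fixes f :: "('a, 'b) path_map \<Rightarrow>\<^sub>0 'k::comm_ring_1"
  assumes f: "Poly_Mapping.keys f \<subseteq> reduced" and rho: "\<And>h y. rho f h y = 0"
  shows "f = 0"
proof (rule ccontr)
  assume "f \<noteq> 0"
  define P where "P = (\<lambda>(p, q). path_star G p q \<in> Poly_Mapping.keys f \<and> pair p q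
    \<and> (length (snd q) = L \<or> \<not> saturated (path_end G q)))"
  obtain s where "s \<in> Poly_Mapping.keys f" using \<open>f \<noteq> 0\<close> by (auto simp flip: keys_eq_empty)
  then have "\<exists>x. P x" using f by (fastforce simp: reduced_def P_def)
  then obtain x0 where "P x0" "\<And>x. P x \<Longrightarrow> length (snd (snd x0)) \<le> length (snd (snd x))"
    using ex_has_least_nat[of P _ "\<lambda>x. length (snd (snd x))"] by blast
  moreover obtain u es v fs where x0: "x0 = ((u, es), (v, fs))" by (metis surj_pair)
  ultimately have P0: "path_star G (u, es) (v, fs) \<in> Poly_Mapping.keys f" "pair (u, es) (v, fs)"
    "length fs = L \<or> \<not> saturated (path_end G (v, fs))"
    and least: "\<And>p q. P (p, q) \<Longrightarrow> length fs \<le> length (snd q)"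
    by (fastforce simp: P_def)+
  define w where "w = path_end G (v, fs)"
  have w: "w \<in> V" and pq: "(u, es) \<in> paths G" "(v, fs) \<in> paths G" "path_end G (u, es) = w"
    "set es \<subseteq> F" "set fs \<subseteq> F" "length es \<le> 2 * L"
    using P0(2) by (auto simp: w_def elim!: pair.cases)
  \<comment> \<open>At an unsaturated vertex \<open>z0\<close> is chosen outside the images of all
    arcs of \<open>F\<close>; at a saturated one any point over \<open>w\<close> will do, since then
    \<open>fs\<close> has the maximal length.\<close>
  obtain z0 where z0: "z0 \<in> D w" "\<And>e z. \<not> saturated w \<Longrightarrow> e \<in> F \<Longrightarrow> z \<in> D (head G e) \<Longrightarrow> z0 \<noteq> g e z"
    using D_free[OF w] D_nonempty[OF w] by blast
  define x y where "x = foldr g fs z0" and "y = foldr g es z0"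
  have only: "s = path_star G (u, es) (v, fs)" if s: "s \<in> Poly_Mapping.keys f" and "(x, y) \<in> act s" for s
  proof -
    obtain u' es' v' fs' where s': "s = path_star G (u', es') (v', fs')" "pair (u', es') (v', fs')"
      "length fs' = L \<or> \<not> saturated (path_end G (v', fs'))"
      using f s by (fastforce simp: reduced_def)
    then have pq': "(u', es') \<in> paths G" "(v', fs') \<in> paths G" "path_end G (u', es') = path_end G (v', fs')"
      "set es' \<subseteq> F" "set fs' \<subseteq> F" "length es' \<le> 2 * L" "length fs' \<le> L"
      by (auto elim!: pair.cases)
    obtain z where z: "x = foldr g fs' z" "y = foldr g es' z" "z \<in> D (path_end G (v', fs'))"
      using \<open>(x, y) \<in> act s\<close> pq' by (auto simp: s' act_path_star)
    have le: "length fs \<le> length fs'"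
      using least[of "(u', es')" "(v', fs')"] s s' by (simp add: P_def)
    have "v = v' \<and> (\<exists>xs. fs' = fs @ xs \<and> z0 = foldr g xs z \<or> fs = fs' @ xs \<and> z = foldr g xs z0)"
      by (rule foldr_comparable) (use pq pq' z z0 in \<open>auto simp: w_def x_def\<close>)
    then obtain xs where "v' = v" and "fs' = fs @ xs \<and> z0 = foldr g xs z \<or> fs = fs' @ xs \<and> z = foldr g xs z0"
      by blast
    from this(2) have eq: "fs' = fs \<and> z = z0"
    proof
      assume *: "fs' = fs @ xs \<and> z0 = foldr g xs z"
      have "xs = []"
      proof (cases xs)
        case (Cons e xs')
        \<comment> \<open>\<open>fs\<close> is properly shorter than \<open>fs'\<close>, hence
          shorter than \<open>L\<close>, so its end is unsaturated; but then \<open>z0\<close> would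
          lie in the image of the arc \<open>e\<close>.\<close>
        then have "\<not> saturated w" using * P0(3) pq'(7) by (auto simp: w_def)
        moreover have "foldr g xs' z \<in> D (head G e)"
          by (rule foldr_in) (use * Cons pq' z in \<open>auto simp: paths_append_iff path_end_append\<close>)
        moreover have "e \<in> F" using * Cons pq' by simp
        ultimately have False using z0(2) * Cons by auto
        then show ?thesis ..
      qed
      then show ?thesis using * by simp
    qed (use le in auto)
    have "u = u' \<and> (\<exists>xs. es' = es @ xs \<and> z0 = foldr g xs z0 \<or> es = es' @ xs \<and> z0 = foldr g xs z0)"
      by (rule foldr_comparable) (use pq pq' z z0 eq \<open>v' = v\<close> in \<open>auto simp: w_def y_def\<close>)
    then obtain xs where "u = u'" "es' = es @ xs \<or> es = es' @ xs" "foldr g xs z0 = z0"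
      by metis
    \<comment> \<open>The surplus \<open>xs\<close> is a piece of \<open>es\<close> or
      \<open>es'\<close>, both of length at most \<open>2 * L\<close>, and it fixes
      \<open>z0\<close>. This is the source of the bound in \<open>no_fixed\<close>.\<close>
    moreover from this have "xs = []"
      using pq(6) pq'(6) by (intro no_fixed[OF z0(1)]) auto
    ultimately show ?thesis using s' eq \<open>v' = v\<close> by auto
  qed
  let ?s = "path_star G (u, es) (v, fs)"
  let ?h = "\<lambda>x'. if x' = x then 1 else 0 :: 'k"
  have sPS: "?s \<in> PS" using pq by (intro path_star_in_PS) (auto simp: w_def)
  have "(x, y) \<in> act ?s"
    using pq z0(1) by (auto simp: act_path_star w_def x_def y_def)
  then have T0: "T ?s ?h y = 1" using sPS by (simp add: T_eq)
  have "T s ?h y = 0" if s: "s \<in> Poly_Mapping.keys f" "s \<noteq> ?s" for s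
  proof -
    have "(x, y) \<notin> act s" using only[OF s(1)] s(2) by blast
    moreover have "s \<in> PS" using f s(1) by (force simp: reduced_def elim!: pair.cases intro!: path_star_in_PS)
    ultimately show ?thesis
      by (cases "\<exists>x'. (x', y) \<in> act s") (auto simp: T_eq_0 T_eq)
  qed
  then have "(\<Sum>s\<in>Poly_Mapping.keys f - {?s}. Poly_Mapping.lookup f s * T s ?h y) = 0"
    by (intro sum.neutral) auto
  then have "rho f ?h y = Poly_Mapping.lookup f ?s"
    unfolding rho_def using P0(1) T0 by (subst sum.remove[of _ ?s]) auto
  then show False using P0(1) rho by (simp add: in_keys_iff)
qed

text \<open>Reduction changes neither the class modulo the ideal nor the operator, and a normal form
  with zero operator is zero.\<close>

lemma rho_eq_0_imp_leavitt_ideal: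
  assumes "Poly_Mapping.keys f \<subseteq> insert {} {path_star G p q | p q. pair p q}"
    and "\<And>h y. rho f h y = 0"
  shows "f \<in> leavitt_ideal"
proof -
  obtain f' where f': "equiv0 (f - f')" "Poly_Mapping.keys f' \<subseteq> reduced"
    using reducible_of_keys[OF assms(1)] by (auto simp: reducible_def)
  then have "rho f' h y = 0" for h y
    using assms(2)[of h y] by (auto simp: equiv0_def rho_diff)
  then have "f' = 0" using reduced_rho_eq_0[OF f'(2)] by blast
  then show ?thesis using f'(1) by (simp add: equiv0_def)
qed

end

section \<open>Finite branching systems for no-exit graphs\<close>

text \<open>
  The points over a vertex are the paths over \<open>F\<close> that avoid cycle arcs and stop at a vertex that
  lies on a cycle or need not satisfy a Cuntz--Krieger relation. A counter modulo \<open>N\<close>, raised by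
  every arc, keeps the powers of a cycle apart.
\<close>

locale no_exit_digraph = wf_digraph G for G :: "('a, 'b) pre_digraph" +
  fixes F :: "'b set" and V :: "'a set" and N :: nat
  assumes no_exit: "no_exit G"
    and fin_F: "finite F" and arcs_F: "F \<subseteq> arcs G"
    and fin_V: "finite V" and ends_V: "tail G ` F \<union> head G ` F \<subseteq> V" and V_verts: "V \<subseteq> verts G"
    and N_pos: "0 < N"
begin

text \<open>The closed path has to run inside \<open>F\<close>. A cycle of \<open>G\<close> that
  leaves \<open>F\<close> counts as acyclic; following it leads to a vertex whose arc is missing
  from \<open>F\<close>, where points may stop.\<close>

definition cyclic :: "'b \<Rightarrow> bool" where
  "cyclic e \<longleftrightarrow> e \<in> F \<and> (\<exists>p. (head G e, p) \<in> paths G \<and> set p \<subseteq> F \<and> path_end G (head G e, p) = tail G e)"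

definition terminal :: "'a \<Rightarrow> bool" where
  "terminal w \<longleftrightarrow> \<not> (regular_vertex G w \<and> out_arcs G w \<subseteq> F) \<or> (\<exists>e. cyclic e \<and> tail G e = w)"

definition points :: "'a \<Rightarrow> ('a \<times> 'b list \<times> nat) set" where
  "points v = {(v, es, j) | es j. v \<in> V \<and> (v, es) \<in> paths G \<and> set es \<subseteq> {e \<in> F. \<not> cyclic e}
    \<and> terminal (path_end G (v, es)) \<and> j < N}"

text \<open>A cyclic arc produces the empty path instead of prefixing itself. Injectivity survives,
  because over a vertex of a cycle in \<open>F\<close> only the empty path occurs.\<close>

definition step :: "'b \<Rightarrow> 'a \<times> 'b list \<times> nat \<Rightarrow> 'a \<times> 'b list \<times> nat" where
  "step e = (\<lambda>(v, es, j). (tail G e, if cyclic e then [] else e # es, (j + 1) mod N))"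

text \<open>The no-exit hypothesis enters the construction here.\<close>

lemma cyclic_unique:
  assumes "cyclic e" "f \<in> arcs G" "tail G f = tail G e" shows "f = e"
  using assms no_exit arcs_F unfolding no_exit_iff cyclic_def by blast

lemma cyclic_next:
  assumes "cyclic e" obtains e' where "cyclic e'" "tail G e' = head G e"
proof -
  obtain p where p: "(head G e, p) \<in> paths G" "set p \<subseteq> F" "path_end G (head G e, p) = tail G e" "e \<in> F"
    using assms by (auto simp: cyclic_def)
  show thesis
  proof (cases p)
    case Nil
    then show thesis using that[of e] p assms by simp
  next
    case (Cons e' q)
    then have t: "tail G e' = head G e" and q: "e' \<in> F" "set q \<subseteq> F" using p by auto
    have "(head G e', q @ [e]) \<in> paths G" "path_end G (head G e', q @ [e]) = head G e"
      using p Cons arcs_F by (auto simp: paths_append_iff path_end_append)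
    then have "cyclic e'"
      unfolding cyclic_def using p(4) q t by (intro conjI exI[of _ "q @ [e]"]) auto
    then show thesis using that t by blast
  qed
qed

text \<open>The head of \<open>e\<close> emits a cyclic arc and no other, while the paths in points
  avoid cyclic arcs.\<close>

lemma points_head_cyclic:
  assumes "cyclic e" "(v, es, j) \<in> points (head G e)" shows "es = []"
proof (cases es)
  case (Cons f fs)
  obtain e' where "cyclic e'" "tail G e' = head G e" using cyclic_next[OF assms(1)] .
  then have "f = e'"
    using assms(2) Cons by (intro cyclic_unique) (auto simp: points_def)
  then show ?thesis using assms(2) Cons \<open>cyclic e'\<close> by (auto simp: points_def)
qed

text \<open>The part between two occurrences of an arc closes up to a cycle over \<open>F\<close>.
  This bounds path lengths by the size of \<open>F\<close> and makes the set of points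
  finite.\<close>

lemma acyclic_path_distinct:
  assumes "(v, es) \<in> paths G" "set es \<subseteq> {e \<in> F. \<not> cyclic e}" shows "distinct es"
proof (rule ccontr)
  assume "\<not> distinct es"
  then obtain xs ys zs e where "es = xs @ [e] @ ys @ [e] @ zs"
    using not_distinct_decomp by blast
  then have "(head G e, ys) \<in> paths G" "path_end G (head G e, ys) = tail G e" "set ys \<subseteq> F" "e \<in> F"
    and "\<not> cyclic e"
    using assms by (auto simp: paths_append_iff path_end_append)
  then show False by (auto simp: cyclic_def)
qed

lemma finite_points: "finite (\<Union>v\<in>V. points v)"
proof (rule finite_subset)
  show "(\<Union>v\<in>V. points v) \<subseteq> V \<times> {es. set es \<subseteq> F \<and> distinct es} \<times> {..<N}"
    using acyclic_path_distinct by (fastforce simp: points_def)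
  show "finite (V \<times> {es. set es \<subseteq> F \<and> distinct es} \<times> {..<N})"
    using fin_V fin_F by (intro finite_cartesian_product finite_subset_distinct) auto
qed

text \<open>A longest path over noncyclic arcs of \<open>F\<close> ends at a terminal vertex:
  otherwise its end has an outgoing arc, which lies in \<open>F\<close>, is not cyclic and prolongs
  the path.\<close>

lemma points_nonempty:
  assumes "v \<in> V" shows "points v \<noteq> {}"
proof -
  define P where "P es \<longleftrightarrow> (v, es) \<in> paths G \<and> set es \<subseteq> {e \<in> F. \<not> cyclic e}" for es
  have "P []" using assms V_verts by (auto simp: P_def)
  moreover have "length es < Suc (card F)" if "P es" for es
  proof -
    have "length es = card (set es)"
      using that acyclic_path_distinct[of v es] by (simp add: P_def distinct_card)
    also have "\<dots> \<le> card F" using that fin_F by (intro card_mono) (auto simp: P_def)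
    finally show ?thesis by simp
  qed
  ultimately obtain es where es: "P es" "\<And>fs. P fs \<Longrightarrow> length fs \<le> length es"
    using ex_has_greatest_nat[of P "[]" length "Suc (card F)"] by (meson less_imp_le_nat)
  have "terminal (path_end G (v, es))"
  proof (rule ccontr)
    assume t: "\<not> terminal (path_end G (v, es))"
    then obtain e where e: "e \<in> out_arcs G (path_end G (v, es))"
      by (auto simp only: terminal_def regular_vertex_def)
    moreover have "e \<in> F" "\<not> cyclic e" using t e by (auto simp: terminal_def)
    ultimately have "P (es @ [e])" using es(1) by (auto simp: P_def paths_append_iff)
    then show False using es(2)[of "es @ [e]"] by simp
  qed
  then have "(v, es, 0) \<in> points v" using es(1) assms N_pos by (auto simp: points_def P_def)
  then show ?thesis by blast
qed

lemma snd_snd_foldr_step: "z \<in> points v \<Longrightarrow> snd (snd (foldr step xs z)) = (snd (snd z) + length xs) mod N"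
  by (induction xs) (auto simp: points_def step_def case_prod_unfold mod_Suc_eq)

sublocale branching_system G F points step
proof unfold_locales
  show "u = v" if "y \<in> points u" "y \<in> points v" for y u v using that by (auto simp: points_def)
next
  fix e y assume e: "e \<in> F" and y: "y \<in> points (head G e)"
  have V: "tail G e \<in> V" "tail G e \<in> verts G" using e ends_V V_verts by auto
  show "step e y \<in> points (tail G e)"
  proof (cases "cyclic e")
    case True
    then show ?thesis using V N_pos by (auto simp: step_def points_def terminal_def split: prod.splits)
  next
    case False
    then show ?thesis using e y V N_pos arcs_F by (auto simp: step_def points_def)
  qed
next
  fix e e' y y'
  assume e: "e \<in> F" "e' \<in> F" and y: "y \<in> points (head G e)" "y' \<in> points (head G e')"
    and eq: "step e y = step e' y'"
  obtain es j where 1: "y = (head G e, es, j)" "j < N" using y(1) by (auto simp: points_def)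
  obtain es' j' where 2: "y' = (head G e', es', j')" "j' < N" using y(2) by (auto simp: points_def)
  have t: "tail G e = tail G e'" and c: "(if cyclic e then [] else e # es) = (if cyclic e' then [] else e' # es')"
    and j: "(j + 1) mod N = (j' + 1) mod N" using eq by (simp_all add: step_def 1 2)
  have "e = e'"
  proof (cases "cyclic e")
    case True
    then show ?thesis using cyclic_unique[OF True, of e'] e arcs_F t by auto
  next
    case False
    then show ?thesis using c by (auto split: if_splits)
  qed
  moreover have "es = es'"
  proof (cases "cyclic e")
    case True
    have "es = []" by (rule points_head_cyclic[OF True]) (use y 1 in simp)
    moreover have "es' = []" by (rule points_head_cyclic[OF True]) (use y 2 \<open>e = e'\<close> in simp)
    ultimately show ?thesis by simp
  next
    case False
    then show ?thesis using c \<open>e = e'\<close> by simp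
  qed
  moreover have "j = j'"
    using j 1(2) 2(2) by (auto simp: mod_Suc split: if_splits)
  ultimately show "e = e' \<and> y = y'" using 1 2 by simp
next
  fix v y assume v: "regular_vertex G v" "out_arcs G v \<subseteq> F" and "y \<in> points v"
  then obtain es j where y: "y = (v, es, j)" "v \<in> V" "(v, es) \<in> paths G" "set es \<subseteq> {e \<in> F. \<not> cyclic e}"
    "terminal (path_end G (v, es))" "j < N" by (auto simp: points_def)
  \<comment> \<open>The predecessor of \<open>j\<close> modulo \<open>N\<close>; adding
    \<open>N - 1\<close> avoids truncated subtraction at \<open>0\<close>.\<close>
  define k where "k = (j + (N - 1)) mod N"
  have k: "k < N" "(k + 1) mod N = j" using y(6) by (auto simp: k_def mod_simps)
  show "\<exists>e\<in>out_arcs G v. \<exists>z\<in>points (head G e). y = step e z"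
  proof (cases es)
    case Nil
    \<comment> \<open>All arcs at the regular vertex \<open>v\<close> lie in \<open>F\<close>, so it
      can be terminal only by lying on a cycle.\<close>
    then obtain e where e: "cyclic e" "tail G e = v" using y v by (auto simp: terminal_def)
    then have F: "e \<in> F" "e \<in> arcs G" "head G e \<in> V" "head G e \<in> verts G"
      using arcs_F ends_V V_verts by (auto simp: cyclic_def)
    obtain e' where "cyclic e'" "tail G e' = head G e" using cyclic_next[OF e(1)] .
    then have "(head G e, [], k) \<in> points (head G e)"
      using F k by (auto simp: points_def terminal_def)
    moreover have "y = step e (head G e, [], k)" using e k y Nil by (simp add: step_def)
    ultimately show ?thesis using e F by (intro bexI[of _ e]) auto
  next
    case (Cons e fs)
    then have "(head G e, fs, k) \<in> points (head G e)"
      using y k ends_V by (auto simp: points_def)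
    moreover have "y = step e (head G e, fs, k)" using y k Cons by (simp add: step_def)
    ultimately show ?thesis using y Cons by (intro bexI[of _ e]) auto
  qed
qed (rule arcs_F)

text \<open>Every arc raises the counter by one, so with \<open>N = 2 * L + 1\<close> at most
  \<open>2 * L\<close> arcs restore it only if there are none.\<close>

lemma faithful_points:
  assumes "N = Suc (2 * L)"
  shows "faithful_branching_system G F points step V L"
proof unfold_locales
  show "head G e \<in> V" if "e \<in> F" for e using that ends_V by auto
  show "points v \<noteq> {}" if "v \<in> V" for v using points_nonempty[OF that] .
next
  fix v assume v: "v \<in> V" and ns: "\<not> (regular_vertex G v \<and> out_arcs G v \<subseteq> F)"
  have "(v, [], 0) \<in> points v"
    using v ns V_verts N_pos by (auto simp: points_def terminal_def)
  moreover have "(v, [], 0) \<noteq> step e z" if "e \<in> F" "z \<in> points (head G e)" for e z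
  proof
    assume "(v, [], 0) = step e z"
    then have "cyclic e" "tail G e = v" by (auto simp: step_def split: prod.splits if_splits)
    \<comment> \<open>An arc whose image contains an empty path is cyclic, hence the only arc at
      \<open>v\<close>, and it lies in \<open>F\<close>. Then \<open>v\<close> would be saturated
      after all.\<close>
    then have "out_arcs G v = {e}" using cyclic_unique[OF \<open>cyclic e\<close>] that(1) arcs_F by auto
    then show False using ns that(1) v V_verts by (auto simp: regular_vertex_def)
  qed
  ultimately show "\<exists>z\<in>points v. \<forall>e\<in>F. \<forall>z'\<in>points (head G e). z \<noteq> step e z'" by blast
next
  fix z v xs assume z: "z \<in> points v" "foldr step xs z = z" and xs: "length xs \<le> 2 * L"
  have j: "snd (snd z) < N" using z(1) by (auto simp: points_def)
  have "(snd (snd z) + length xs) mod N = snd (snd z)"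
    using snd_snd_foldr_step[OF z(1), of xs] z(2) by simp
  then show "xs = []"
  proof (cases "snd (snd z) + length xs < N")
    case False
    then have "(snd (snd z) + length xs) mod N = snd (snd z) + length xs - N"
      using j xs assms by (subst le_mod_geq) auto
    then show ?thesis
      using \<open>(snd (snd z) + length xs) mod N = snd (snd z)\<close> False xs assms by simp
  qed simp
qed

end

section \<open>Stable finiteness for no-exit graphs\<close>

context wf_digraph
begin

text \<open>The end vertices are bounded by a separate set \<open>V\<close> because a vertex element
  \<open>vv\<^sup>*\<close> involves no arcs.\<close>

definition represented :: "'b set \<Rightarrow> 'a set \<Rightarrow> nat \<Rightarrow> ('a, 'b) path_map \<Rightarrow> bool" where
  "represented F V L s \<longleftrightarrow> s = {} \<or> (\<exists>u es v fs. s = path_star G (u, es) (v, fs) \<and> (u, es) \<in> paths G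
    \<and> (v, fs) \<in> paths G \<and> path_end G (u, es) = path_end G (v, fs) \<and> path_end G (v, fs) \<in> V
    \<and> set es \<subseteq> F \<and> set fs \<subseteq> F \<and> length es \<le> L \<and> length fs \<le> L)"

lemma represented_mono:
  assumes "represented F V L s" "F \<subseteq> F'" "V \<subseteq> V'" "L \<le> L'" shows "represented F' V' L' s"
proof (cases "s = {}")
  case False
  then obtain u es v fs where "s = path_star G (u, es) (v, fs)" "(u, es) \<in> paths G"
    "(v, fs) \<in> paths G" "path_end G (u, es) = path_end G (v, fs)" "path_end G (v, fs) \<in> V"
    "set es \<subseteq> F" "set fs \<subseteq> F" "length es \<le> L" "length fs \<le> L"
    using assms(1) unfolding represented_def by blast
  then show ?thesis
    unfolding represented_def using assms(2-)
    by (intro disjI2 exI[of _ u] exI[of _ es] exI[of _ v] exI[of _ fs]) auto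
qed (simp add: represented_def)

lemma finite_PS_represented:
  assumes "finite K" "K \<subseteq> PS"
  shows "\<exists>F V L. finite F \<and> F \<subseteq> arcs G \<and> finite V \<and> V \<subseteq> verts G \<and> (\<forall>s\<in>K. represented F V L s)"
  using assms
proof (induction K rule: finite_induct)
  case (insert s K)
  have "K \<subseteq> PS" using insert.prems by simp
  from insert.IH[OF this] obtain F V L where IH: "finite F" "F \<subseteq> arcs G" "finite V" "V \<subseteq> verts G"
    "\<forall>s\<in>K. represented F V L s" by blast
  have "s \<in> PS" using insert.prems by simp
  then show ?case
  proof (cases rule: PS_cases)
    case 1
    then have "represented F V L s" by (simp add: represented_def)
    then show ?thesis using IH by (intro exI[of _ F] exI[of _ V] exI[of _ L]) simp
  next
    case (2 u es v fs)
    let ?F = "F \<union> set es \<union> set fs" and ?V = "insert (path_end G (v, fs)) V" and ?L = "L + length es + length fs"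
    have "represented ?F ?V ?L s"
      unfolding represented_def
      by (rule disjI2, rule exI[of _ u], rule exI[of _ es], rule exI[of _ v], rule exI[of _ fs]) (use 2 in auto)
    moreover have "\<forall>t\<in>K. represented ?F ?V ?L t"
      using IH(5) by (auto intro: represented_mono)
    moreover have "finite ?F" "?F \<subseteq> arcs G" "finite ?V" "?V \<subseteq> verts G"
      using IH 2 path_arcs[of u es] path_arcs[of v fs] path_end_in_verts[of "(v, fs)"] by auto
    ultimately show ?thesis by (intro exI[of _ ?F] exI[of _ ?V] exI[of _ ?L]) (simp only: ball_simps simp_thms)
  qed
qed (auto intro: exI[of _ "{}"])

text \<open>The two directions of the test for the ideal make opposite demands: elements of the
  ideal must act as zero, which holds for large \<open>F\<close>, and all others must not, which is
  faithfulness for path lengths up to \<open>L\<close>. The bound \<open>L\<close> depends on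
  \<open>Z\<close> only, so \<open>F\<close> can be enlarged before the system is built.\<close>

lemma leavitt_representation:
  fixes Z :: "(('a, 'b) path_map \<Rightarrow>\<^sub>0 'k::comm_ring_1) set"
  assumes no_exit: "no_exit G" and Z: "finite Z" "\<And>f. f \<in> Z \<Longrightarrow> Poly_Mapping.keys f \<subseteq> PS"
  shows "\<exists>(Y::('a \<times> 'b list \<times> nat) set) (\<kappa>::(('a, 'b) path_map \<Rightarrow>\<^sub>0 'k) \<Rightarrow> _ \<Rightarrow> _ \<Rightarrow> 'k). finite Y
      \<and> (\<forall>f g x y. \<kappa> (f + g) x y = \<kappa> f x y + \<kappa> g x y)
      \<and> (\<forall>f\<in>Z. \<forall>g\<in>Z. \<forall>x\<in>Y. \<forall>y\<in>Y. \<kappa> (conv pm_comp f g) x y = kmult Y (\<kappa> f) (\<kappa> g) x y)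
      \<and> (\<forall>f\<in>Z. f \<in> leavitt_ideal \<longleftrightarrow> (\<forall>x\<in>Y. \<forall>y\<in>Y. \<kappa> f x y = 0))"
proof -
  have "finite (\<Union>f\<in>Z. Poly_Mapping.keys f)" "(\<Union>f\<in>Z. Poly_Mapping.keys f) \<subseteq> PS"
    using Z by auto
  from finite_PS_represented[OF this] obtain F0 V0 L where
    F0: "finite F0" "F0 \<subseteq> arcs G" and V0: "finite V0" "V0 \<subseteq> verts G"
    and K': "\<forall>s\<in>(\<Union>f\<in>Z. Poly_Mapping.keys f). represented F0 V0 L s"
    by (elim exE conjE)
  have K: "represented F0 V0 L s" if "f \<in> Z" "s \<in> Poly_Mapping.keys f" for f s
    using K' that by blast
  have "\<forall>\<^sub>F F in finite_subsets_at_top (arcs G). \<forall>f\<in>Z \<inter> leavitt_ideal. vanishing TYPE('a \<times> 'b list \<times> nat) F f"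
    using Z(1) by (intro eventually_ball_finite ballI leavitt_ideal_vanishing) auto
  moreover have "\<forall>\<^sub>F F in finite_subsets_at_top (arcs G). finite F \<and> F0 \<subseteq> F \<and> F \<subseteq> arcs G"
    unfolding eventually_finite_subsets_at_top using F0 by auto
  ultimately have "\<forall>\<^sub>F F in finite_subsets_at_top (arcs G).
      (\<forall>f\<in>Z \<inter> leavitt_ideal. vanishing TYPE('a \<times> 'b list \<times> nat) F f) \<and> finite F \<and> F0 \<subseteq> F \<and> F \<subseteq> arcs G"
    by eventually_elim auto
  from eventually_happens[OF this] obtain F where
    van: "\<And>f. f \<in> Z \<Longrightarrow> f \<in> leavitt_ideal \<Longrightarrow> vanishing TYPE('a \<times> 'b list \<times> nat) F f"
    and F: "finite F" "F0 \<subseteq> F" "F \<subseteq> arcs G"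
    by (auto simp: finite_subsets_at_top_neq_bot)
  define V where "V = V0 \<union> tail G ` F \<union> head G ` F"
  interpret no_exit_digraph G F V "Suc (2 * L)"
    by unfold_locales (use no_exit F V0 in \<open>auto simp: V_def\<close>)
  interpret faithful_branching_system G F points step V L
    by (rule faithful_points) simp
  define Y where "Y = (\<Union>v\<in>V. points v)"
  have fin: "finite Y" unfolding Y_def by (rule finite_points)
  \<comment> \<open>Indicator functions serve as the standard basis: \<open>\<kappa> f x y\<close>
    is the entry in row \<open>x\<close> and column \<open>y\<close> of the matrix of
    \<open>rho f\<close>.\<close>
  define \<delta> where "\<delta> y x = (if x = y then 1 else 0 :: 'k)" for y x :: "'a \<times> 'b list \<times> nat"
  define \<kappa> where "\<kappa> f x y = rho f (\<delta> y) x" for f :: "('a, 'b) path_map \<Rightarrow>\<^sub>0 'k" and x y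
  have balanced: "Poly_Mapping.keys f \<subseteq> {s \<in> PS. arcs_balanced F s}" if "f \<in> Z" for f
  proof
    fix s assume s: "s \<in> Poly_Mapping.keys f"
    then have "arcs_balanced F s"
      using represented_mono[OF K[OF that s] F(2) order_refl order_refl]
      by (auto simp: represented_def arcs_balanced_def[of _ "{}"] intro!: arcs_balanced_path_star)
    then show "s \<in> {s \<in> PS. arcs_balanced F s}" using Z(2)[OF that] s by auto
  qed
  \<comment> \<open>No points lie over vertices outside \<open>V\<close>, so every point that is
    moved and every image lies in the finite set \<open>Y\<close>. Hence each operator is determined
    by its matrix on \<open>Y\<close>.\<close>
  have act_Y: "x \<in> Y" "y \<in> Y" if s: "s \<in> PS" "(x, y) \<in> act s" for s x y
  proof -
    obtain u a v b z where 1: "((u, a), (v, b)) \<in> s" "set a \<subseteq> F" "set b \<subseteq> F"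
      "z \<in> points (path_end G (u, a))" "x = foldr step a z" "y = foldr step b z"
      using s(2) by (rule actE)
    have "x \<in> points u" "y \<in> points v"
      using foldr_in[of u a z] foldr_in[of v b z] 1 PS_paths[OF s(1) 1(1)] by auto
    then show "x \<in> Y" "y \<in> Y" by (auto simp: Y_def points_def)
  qed
  have T_expand: "T s h y = (\<Sum>z\<in>Y. h z * T s (\<delta> z) y)" if s: "s \<in> PS" for s y and h :: "_ \<Rightarrow> 'k"
  proof (cases "\<exists>x. (x, y) \<in> act s")
    case True
    then obtain x where x: "(x, y) \<in> act s" by blast
    then have "(\<Sum>z\<in>Y. h z * T s (\<delta> z) y) = (\<Sum>z\<in>Y. if z = x then h z else 0)"
      using s by (intro sum.cong refl) (simp add: T_eq \<delta>_def)
    also have "\<dots> = h x" using fin act_Y(1)[OF s x] by simp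
    finally show ?thesis using s x by (simp add: T_eq)
  next
    case False
    have "T s h y = 0" for h :: "_ \<Rightarrow> 'k" by (rule T_eq_0) (use False in blast)
    then show ?thesis by simp
  qed
  have rho_expand: "rho f h y = (\<Sum>z\<in>Y. rho f (\<delta> z) y * h z)" if f: "f \<in> Z" for f h y
  proof -
    have "rho f h y = (\<Sum>s\<in>Poly_Mapping.keys f. \<Sum>z\<in>Y. Poly_Mapping.lookup f s * (h z * T s (\<delta> z) y))"
      unfolding rho_def sum_distrib_left[symmetric] using Z(2)[OF f]
      by (intro sum.cong refl) (simp add: T_expand[symmetric] subset_iff)
    also have "\<dots> = (\<Sum>z\<in>Y. rho f (\<delta> z) y * h z)"
      unfolding rho_def by (subst sum.swap) (simp add: sum_distrib_right sum_distrib_left ac_simps)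
    finally show ?thesis .
  qed
  have "\<kappa> (f + g) x y = \<kappa> f x y + \<kappa> g x y" for f g x y by (simp add: \<kappa>_def rho_add)
  moreover have "\<kappa> (conv pm_comp f g) x y = kmult Y (\<kappa> f) (\<kappa> g) x y" if "f \<in> Z" "g \<in> Z" for f g x y
    using that by (simp add: \<kappa>_def kmult_def rho_conv balanced flip: rho_expand)
  moreover have "f \<in> leavitt_ideal \<longleftrightarrow> (\<forall>x\<in>Y. \<forall>y\<in>Y. \<kappa> f x y = 0)" if f: "f \<in> Z" for f
  proof
    assume "f \<in> leavitt_ideal"
    then have "rho f h x = 0" for h x
      using van[OF f] branching_system_axioms unfolding vanishing_def by blast
    then show "\<forall>x\<in>Y. \<forall>y\<in>Y. \<kappa> f x y = 0" by (simp add: \<kappa>_def)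
  next
    assume 0: "\<forall>x\<in>Y. \<forall>y\<in>Y. \<kappa> f x y = 0"
    have "rho f h x = 0" for h x
    proof (cases "x \<in> Y")
      case True
      then show ?thesis using 0 by (subst rho_expand[OF f]) (simp add: \<kappa>_def)
    next
      case False
      then have "T s h x = 0" if "s \<in> Poly_Mapping.keys f" for s
        using act_Y(2) Z(2)[OF f] that by (intro T_eq_0) blast
      then show ?thesis by (simp add: rho_def)
    qed
    moreover have "Poly_Mapping.keys f \<subseteq> insert {} {path_star G p q | p q. pair p q}"
    proof
      fix s assume "s \<in> Poly_Mapping.keys f"
      then consider "s = {}" | u es v fs where "s = path_star G (u, es) (v, fs)" "(u, es) \<in> paths G"
          "(v, fs) \<in> paths G" "path_end G (u, es) = path_end G (v, fs)" "path_end G (v, fs) \<in> V0"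
          "set es \<subseteq> F0" "set fs \<subseteq> F0" "length es \<le> L" "length fs \<le> L"
        using K[OF f] unfolding represented_def by blast
      then show "s \<in> insert {} {path_star G p q | p q. pair p q}"
      proof cases
        case 2
        then have "pair (u, es) (v, fs)" using F(2) by (intro pairI) (auto simp: V_def)
        then show ?thesis using 2(1) by blast
      qed simp
    qed
    ultimately show "f \<in> leavitt_ideal" by (intro rho_eq_0_imp_leavitt_ideal)
  qed
  ultimately show ?thesis using fin by (intro exI[of _ Y] exI[of _ \<kappa>]) blast
qed

lemma stably_finite_imp_dedekind_finite:
  "stably_finite (leavitt_path_algebra TYPE('k::comm_ring_1) G)
    \<Longrightarrow> dedekind_finite (leavitt_path_algebra TYPE('k) G)"
  unfolding leavitt_path_algebra_eq stably_finite_def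
  by (rule leavitt.dedekind_finite_of_matrix_rng) simp

lemma no_exit_imp_stably_finite:
  assumes "no_exit G" shows "stably_finite (leavitt_path_algebra TYPE('k::comm_ring_1) G)"
  unfolding leavitt_path_algebra_eq stably_finite_def
  by (intro allI impI leavitt.dedekind_finite_matrix_rng[where 'y = "'a \<times> 'b list \<times> nat"]
      leavitt_representation[OF assms])

lemma dedekind_finite_imp_no_exit:
  assumes "dedekind_finite (leavitt_path_algebra TYPE('k::comm_ring_1) G)" shows "no_exit G"
  unfolding no_exit_iff using exit_not_dedekind_finite assms by blast

end

theorem theorem4p13:
  fixes E :: "('a, 'b) pre_digraph"
  assumes "wf_digraph E"
  shows "(stably_finite (leavitt_path_algebra TYPE('k::comm_ring_1) E)
            \<longleftrightarrow> dedekind_finite (leavitt_path_algebra TYPE('k) E))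
       \<and> (dedekind_finite (leavitt_path_algebra TYPE('k) E) \<longleftrightarrow> no_exit E)"
proof -
  interpret wf_digraph E by (rule assms)
  show ?thesis
    using stably_finite_imp_dedekind_finite no_exit_imp_stably_finite dedekind_finite_imp_no_exit by blast
qed

end
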